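(* Assume $\log(T)=o(n)$. For any sequence $\{r_{n,T}\}_{n,T\ge1}$ increasing to infinity such that $r_{n,T}=o(n^{1/4})$, for any $\epsilon>0$, the variational estimator $\tilde\pi$ satisfies $$\frac12\,\mathbb{P}_{\theta^*}\left(\min_{\sigma\in\mathfrak{S}_Q}\|\tilde\pi_\sigma-\pi^*\|_\infty>\frac{\epsilon\, r_{n,T}}{n^{1/4}}\right)\xrightarrow[n,T\to\infty]{}0 .$$
   Context: Notation: $[M]=\{1,\dots,M\}$. Fix the number of classes $Q\ge 2$ and constants $0<\delta<1/Q$, $0<\zeta<1/2$. Model. There are $n$ nodes observed at times $t=1,\dots,T$. The latent labels $Z_i=(Z_i^1,\dots,Z_i^T)$, $i\in[n]$, are i.i.d. homogeneous stationary Markov chains on $[Q]$ with transition matrix $\Gamma=(\gamma_{ql})_{q,l\in[Q]}$, $\gamma_{ql}=\mathbb{P}(Z_i^{t+1}=l\mid Z_i^t=q)$, started from the stationary distribution $\alpha=(\alpha_q)_{q\in[Q]}$ of $\Gamma$. Write $Z^t=(Z_1^t,\dots,Z_n^t)$, $Z^{1:T}=(Z^1,\dots,Z^T)$. The observations $X^{1:T}=(X^1,\dots,X^T)$ are symmetric binary adjacency matrices $X^t=(X^t_{ij})_{i,j\in[n]}$ with $X^t_{ii}=0$; conditionally on $Z^{1:T}$, the $X^t_{ij}$ ($i<j$, $t\in[T]$) are independent and $X^t_{ij}$ is Bernoulli with parameter $\pi_{Z^t_iZ^t_j}$, where $\pi=(\pi_{ql})$ is a symmetric $Q\times Q$ matrix.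 The parameter is $\theta=(\Gamma,\pi)$ and $\mathbb{P}_\theta$ is the law of all variables under $\theta$. $\Theta$ is the set of $\theta=(\Gamma,\pi)$ with $\Gamma$ stochastic and $\pi$ symmetric such that: for all $q\ne q'$ there is $l$ with $\pi_{ql}\neq\pi_{q'l}$; $\gamma_{ql}\in[\delta,1-\delta]$ for all $q,l$; $\pi_{ql}\in[\zeta,1-\zeta]$ for all $q,l$. The true parameter is $\theta^*=(\Gamma^*,\pi^* )\in\Theta$. Variational estimator. The variational family consists of the laws $\mathbb{Q}_\chi$ of $Z^{1:T}$, $\chi=(\tau,\eta)=(\{\tau^t_{iq}\},\{\eta^t_{iql}\})$ with entries in $[0,1]$, under which $Z_1,\dots,Z_n$ are independent, each $Z_i$ is a (possibly inhomogeneous) Markov chain on $[Q]$, $\mathbb{Q}_\chi(Z_i^t=q)=\tau^t_{iq}$ and $\mathbb{Q}_\chi(Z_i^t=q,Z_i^{t+1}=l)=\eta^t_{iql}$. With $\ell(\theta)=\log\mathbb{P}_\theta(X^{1:T})$ and $KL$ the Kullback–Leibler divergence, $$\mathcal{J}(\chi,\theta)=\ell(\theta)-KL\left(\mathbb{Q}_\chi,\mathbb{P}_\theta(Z^{1:T}=\cdot\mid X^{1:T})\right),\quad \hat\chi(\theta)=\operatorname{argmax}_\chi\mathcal{J}(\chi,\theta),\quad \tilde\theta=(\tilde\Gamma,\tilde\pi)=\operatorname{argmax}_{\theta\in\Theta}\mathcal{J}(\hat\chi(\theta),\theta).$$ $\mathfrak{S}_Q$ is the set of permutations of $[Q]$,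 $\pi_\sigma=(\pi_{\sigma(q)\sigma(l)})_{q,l}$, $\|\pi-\pi'\|_\infty=\max_{q,l}|\pi_{ql}-\pi'_{ql}|$. Asymptotics: limits and $o(\cdot)$ are for $n\to\infty$ and $T\to\infty$ jointly; $\log T=o(n)$ restricts the joint regime. A sequence increasing to infinity is a positive sequence tending to $+\infty$ in this regime. *)

theory Defs
  imports "HOL-Probability.Probability" "HOL-Library.Landau_Symbols" "HOL-Library.Monad_Syntax"
begin

text \<open>
  The label set $[Q]$ is a finite type \<open>'q\<close> with \<open>CARD('q) = Q\<close>; nodes are \<open>{1..n}\<close> and times
  are \<open>{1..T}\<close>. A labelling \<open>Z\<close> gives the label \<open>Z i t\<close> of node \<open>i\<close> at time \<open>t\<close>, and is
  \<open>undefined\<close> outside these ranges. An observation \<open>X\<close> gives \<open>X t i j\<close>, the entry \<open>(i, j)\<close>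
  of the binary adjacency matrix at time \<open>t\<close>, and is \<open>False\<close> outside these ranges.
\<close>

type_synonym 'q labelling = "nat \<Rightarrow> nat \<Rightarrow> 'q"
type_synonym adjacency = "nat \<Rightarrow> nat \<Rightarrow> nat \<Rightarrow> bool"
type_synonym 'q param = "(real ^ 'q ^ 'q) \<times> (real ^ 'q ^ 'q)"

section \<open>Model\<close>

text \<open>
  Law of the path over \<open>{1..T}\<close> of a Markov chain with initial law \<open>p\<close>; \<open>K t q\<close> is the law of
  the state at time \<open>Suc t\<close> given state \<open>q\<close> at time \<open>t\<close>.
\<close>

primrec markov_chain :: "'q pmf \<Rightarrow> (nat \<Rightarrow> 'q \<Rightarrow> 'q pmf) \<Rightarrow> nat \<Rightarrow> (nat \<Rightarrow> 'q) pmf" where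
  "markov_chain p K 0 = return_pmf (\<lambda>_. undefined)"
| "markov_chain p K (Suc t) =
     do {
       z \<leftarrow> markov_chain p K t;
       q \<leftarrow> (if t = 0 then p else K t (z t));
       return_pmf (z(Suc t := q))
     }"

definition stochastic :: "real ^ ('q::finite) ^ 'q \<Rightarrow> bool" where
  "stochastic \<Gamma> \<longleftrightarrow> (\<forall>q l. 0 \<le> \<Gamma> $ q $ l) \<and> (\<forall>q. (\<Sum>l\<in>UNIV. \<Gamma> $ q $ l) = 1)"

definition transition :: "real ^ ('q::finite) ^ 'q \<Rightarrow> 'q \<Rightarrow> 'q pmf" where
  "transition \<Gamma> q = embed_pmf (\<lambda>l. \<Gamma> $ q $ l)"

definition stationary_law :: "real ^ ('q::finite) ^ 'q \<Rightarrow> 'q pmf" where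
  "stationary_law \<Gamma> = (THE p. bind_pmf p (transition \<Gamma>) = p)"

definition label_law :: "nat \<Rightarrow> nat \<Rightarrow> real ^ ('q::finite) ^ 'q \<Rightarrow> 'q labelling pmf" where
  "label_law n T \<Gamma> = Pi_pmf {1..n} (\<lambda>_. undefined)
     (\<lambda>_. markov_chain (stationary_law \<Gamma>) (\<lambda>_. transition \<Gamma>) T)"

definition dyads :: "nat \<Rightarrow> nat \<Rightarrow> (nat \<times> nat \<times> nat) set" where
  "dyads n T = {(t, i, j). t \<in> {1..T} \<and> i \<in> {1..n} \<and> j \<in> {1..n} \<and> i < j}"

definition symmetrize :: "(nat \<times> nat \<times> nat \<Rightarrow> bool) \<Rightarrow> adjacency" where
  "symmetrize e t i j \<longleftrightarrow> (if i < j then e (t, i, j) else if j < i then e (t, j, i) else False)"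

definition observation_law ::
    "nat \<Rightarrow> nat \<Rightarrow> real ^ ('q::finite) ^ 'q \<Rightarrow> 'q labelling \<Rightarrow> adjacency pmf" where
  "observation_law n T \<pi> Z = map_pmf symmetrize
     (Pi_pmf (dyads n T) False (\<lambda>(t, i, j). bernoulli_pmf (\<pi> $ Z i t $ Z j t)))"

definition dsbm :: "nat \<Rightarrow> nat \<Rightarrow> ('q::finite) param \<Rightarrow> ('q labelling \<times> adjacency) pmf" where
  "dsbm n T \<theta> =
     do {
       Z \<leftarrow> label_law n T (fst \<theta>);
       X \<leftarrow> observation_law n T (snd \<theta>) Z;
       return_pmf (Z, X)
     }"

definition adjacencies :: "nat \<Rightarrow> nat \<Rightarrow> adjacency set" where
  "adjacencies n T = {X. (\<forall>t i j. X t i j \<longrightarrow> t \<in> {1..T} \<and> i \<in> {1..n} \<and> j \<in> {1..n}) \<and>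
     (\<forall>t i j. X t i j = X t j i) \<and> (\<forall>t i. \<not> X t i i)}"

definition Params :: "real \<Rightarrow> real \<Rightarrow> ('q::finite) param set" where
  "Params \<delta> \<zeta> = {(\<Gamma>, \<pi>). stochastic \<Gamma> \<and> transpose \<pi> = \<pi> \<and>
     (\<forall>q q'. q \<noteq> q' \<longrightarrow> (\<exists>l. \<pi> $ q $ l \<noteq> \<pi> $ q' $ l)) \<and>
     (\<forall>q l. \<Gamma> $ q $ l \<in> {\<delta>..1 - \<delta>}) \<and>
     (\<forall>q l. \<pi> $ q $ l \<in> {\<zeta>..1 - \<zeta>})}"

definition log_likelihood :: "nat \<Rightarrow> nat \<Rightarrow> adjacency \<Rightarrow> ('q::finite) param \<Rightarrow> real" where
  "log_likelihood n T X \<theta> = ln (pmf (map_pmf snd (dsbm n T \<theta>)) X)"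

definition posterior :: "nat \<Rightarrow> nat \<Rightarrow> adjacency \<Rightarrow> ('q::finite) param \<Rightarrow> 'q labelling pmf" where
  "posterior n T X \<theta> = map_pmf fst (cond_pmf (dsbm n T \<theta>) {(Z, X'). X' = X})"

section \<open>Variational approximation\<close>

text \<open>
  A variational parameter \<open>(\<tau>, \<eta>)\<close> has entries \<open>\<tau> t i q\<close> and \<open>\<eta> t i q l\<close>. Only the entries with
  \<open>i \<in> {1..n}\<close> and \<open>t \<in> {1..T}\<close> (resp. \<open>t \<in> {1..<T}\<close>) matter; being probabilities of some law,
  they are automatically in $[0,1]$. They determine the law.
\<close>

type_synonym 'q vparam = "(nat \<Rightarrow> nat \<Rightarrow> 'q \<Rightarrow> real) \<times> (nat \<Rightarrow> nat \<Rightarrow> 'q \<Rightarrow> 'q \<Rightarrow> real)"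

definition is_variational_law :: "nat \<Rightarrow> nat \<Rightarrow> 'q vparam \<Rightarrow> 'q labelling pmf \<Rightarrow> bool" where
  "is_variational_law n T chi D \<longleftrightarrow>
     (\<exists>p K. D = Pi_pmf {1..n} (\<lambda>_. undefined) (\<lambda>i. markov_chain (p i) (K i) T)) \<and>
     (\<forall>i\<in>{1..n}. \<forall>t\<in>{1..T}. \<forall>q.
        measure_pmf.prob D {Z. Z i t = q} = fst chi t i q) \<and>
     (\<forall>i\<in>{1..n}. \<forall>t\<in>{1..<T}. \<forall>q l.
        measure_pmf.prob D {Z. Z i t = q \<and> Z i (Suc t) = l} = snd chi t i q l)"

definition Vparams :: "nat \<Rightarrow> nat \<Rightarrow> 'q vparam set" where
  "Vparams n T = {chi. \<exists>D. is_variational_law n T chi D}"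

definition variational_law :: "nat \<Rightarrow> nat \<Rightarrow> 'q vparam \<Rightarrow> 'q labelling pmf" where
  "variational_law n T chi = (THE D. is_variational_law n T chi D)"

text \<open>
  The reference measure is the first measure argument of \<^const>\<open>KL_divergence\<close>, so the divergence
  below is $KL(Q_\chi, P_\theta(Z = \cdot \mid X))$, in natural logarithm.
\<close>

definition elbo :: "nat \<Rightarrow> nat \<Rightarrow> adjacency \<Rightarrow> 'q vparam \<Rightarrow> ('q::finite) param \<Rightarrow> real" where
  "elbo n T X chi \<theta> = log_likelihood n T X \<theta> -
     KL_divergence (exp 1) (measure_pmf (posterior n T X \<theta>)) (measure_pmf (variational_law n T chi))"

text \<open>
  The maximisers below need not be unique. The first maximum is attained for all
  \<open>\<theta> \<in> Params \<delta> \<zeta>\<close>, \<open>X \<in> adjacencies n T\<close>. The second one need not be, since \<open>Params \<delta> \<zeta>\<close> is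
  not closed (e.g. for the empty graphs, where all entries of \<open>\<pi>\<close> would have to equal \<open>\<zeta>\<close>); there
  the estimator is left arbitrary.
\<close>

definition is_chi_hat ::
    "real \<Rightarrow> real \<Rightarrow> (nat \<Rightarrow> nat \<Rightarrow> adjacency \<Rightarrow> ('q::finite) param \<Rightarrow> 'q vparam) \<Rightarrow> bool" where
  "is_chi_hat \<delta> \<zeta> chi_hat \<longleftrightarrow>
     (\<forall>n\<ge>1. \<forall>T\<ge>1. \<forall>X\<in>adjacencies n T. \<forall>\<theta>\<in>Params \<delta> \<zeta>.
        is_arg_max (\<lambda>chi. elbo n T X chi \<theta>) (\<lambda>chi. chi \<in> Vparams n T) (chi_hat n T X \<theta>))"

definition is_variational_estimator ::
    "real \<Rightarrow> real \<Rightarrow> (nat \<Rightarrow> nat \<Rightarrow> adjacency \<Rightarrow> ('q::finite) param \<Rightarrow> 'q vparam) \<Rightarrow>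
     (nat \<Rightarrow> nat \<Rightarrow> adjacency \<Rightarrow> 'q param) \<Rightarrow> bool" where
  "is_variational_estimator \<delta> \<zeta> chi_hat \<theta>est \<longleftrightarrow>
     (\<forall>n\<ge>1. \<forall>T\<ge>1. \<forall>X\<in>adjacencies n T.
        let is_max = is_arg_max (\<lambda>\<theta>. elbo n T X (chi_hat n T X \<theta>) \<theta>) (\<lambda>\<theta>. \<theta> \<in> Params \<delta> \<zeta>)
        in (\<exists>\<theta>. is_max \<theta>) \<longrightarrow> is_max (\<theta>est n T X))"

section \<open>Distance up to label switching\<close>

definition permute_labels :: "('q::finite \<Rightarrow> 'q) \<Rightarrow> real ^ ('q::finite) ^ 'q \<Rightarrow> real ^ ('q::finite) ^ 'q" where
  "permute_labels \<sigma> \<pi> = (\<chi> q l. \<pi> $ \<sigma> q $ \<sigma> l)"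

definition max_norm :: "real ^ ('q::finite) ^ 'q \<Rightarrow> real" where
  "max_norm A = (MAX (q, l) \<in> UNIV. \<bar>A $ q $ l\<bar>)"

end

theory Submission
  imports Defs "HOL-Real_Asymp.Real_Asymp"
begin

text \<open>
  Let \<open>J(\<theta>)\<close> be the variational objective at the optimal \<open>chi\<close>. It lies between the complete
  log-likelihood of any labelling (take a point mass as variational law) and the marginal
  log-likelihood, which is at most the largest conditional log-likelihood of the graphs given labels.
  As all transition probabilities are at least \<open>\<delta>\<close>, these bounds differ from a conditional
  log-likelihood by at most \<open>n T ln (1 / \<delta>)\<close>. So up to an error of order \<open>n T\<close> the estimator
  maximises the conditional log-likelihood jointly over labellings and parameters
  (\<open>elbo_optimal_ge_complete\<close>, \<open>log_likelihood_le_complete\<close>).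

  On an event of high probability this is a deterministic problem. The gap between the conditional
  log-likelihood at \<open>(z, \<pi>)\<close> and at the truth \<open>(Z, \<pi>')\<close> is minus a sum of Bernoulli divergences,
  which is at least quadratic in the differences of connection probabilities, plus noise that is
  linear in the centred graphs and has block constant weights. When the
  centred graphs have sums of at most \<open>n powr (3 / 2)\<close> over all rectangles, the noise has order
  \<open>n powr (3 / 2) * T\<close> uniformly in \<open>z\<close> and \<open>\<pi>\<close> (\<open>log_likelihood_gap_le\<close>). So a \<open>\<theta>\<close> with
  \<open>J(\<theta>) \<ge> J(\<theta>')\<close> comes with a labelling whose squared differences sum to \<open>O(n powr (3 / 2))\<close> at some
  time. When every true class has size of order \<open>n\<close> at that time, each squared difference between
  matched blocks is counted of order \<open>n\<^sup>2\<close> times, hence is \<open>O(n powr (- 1 / 2))\<close>, and the matching is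
  a permutation because the rows of \<open>\<pi>'\<close> are distinct (\<open>block_matching\<close>, \<open>near_optimal_close\<close>). This gives
  an error of at most a constant times \<open>n powr (- 1 / 4)\<close>, which is below the threshold
  as soon as \<open>r\<close> exceeds a constant.

  The parameter set is not closed, so that the estimator is a maximiser has to be proved
  (\<open>estimator_close\<close>): by the above, all candidates for the maximum lie in a compact set on which the
  rows of \<open>\<pi>\<close> remain distinct, and \<open>J\<close> is continuous there because the stationary law depends
  continuously on the transition matrix.

  The event has high probability by Hoeffding's inequality and union bounds over the times, the
  classes and the \<open>4 ^ n\<close> rectangles; the number of times is harmless as \<open>ln T = o(n)\<close>.
\<close>

section \<open>Stationary laws of positive transition matrices\<close>

lemma pmf_transition:
  assumes "stochastic \<Gamma>"
  shows "pmf (transition \<Gamma> q) l = \<Gamma> $ q $ l"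
proof -
  have "(\<integral>\<^sup>+ l. ennreal (\<Gamma> $ q $ l) \<partial>count_space UNIV) = ennreal (\<Sum>l\<in>UNIV. \<Gamma> $ q $ l)"
    using assms by (subst nn_integral_count_space_finite) (auto simp: stochastic_def intro!: sum_ennreal)
  with assms show ?thesis
    unfolding transition_def by (subst pmf_embed_pmf) (auto simp: stochastic_def)
qed

lemma sum_pmf_UNIV: "(\<Sum>q\<in>UNIV. pmf p (q :: 'q :: finite)) = 1"
  by (rule sum_pmf_eq_1) auto

lemma pmf_bind_transition:
  assumes "stochastic \<Gamma>"
  shows "pmf (bind_pmf p (transition \<Gamma>)) l = (\<Sum>q\<in>UNIV. pmf p q * \<Gamma> $ q $ l)"
  by (subst pmf_bind, subst integral_measure_pmf_real[of UNIV])
     (auto simp: pmf_transition[OF assms] mult.commute)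

text \<open>
  Doeblin's argument. Subtracting \<open>\<delta>\<close> from every entry of \<open>\<Gamma>'\<close> does not change its action on
  the difference \<open>p - p'\<close>, which has total mass zero, but shrinks its row sums to \<open>1 - \<delta> Q\<close>; so \<open>\<Gamma>'\<close>
  contracts the \<open>L\<^sup>1\<close> norm of the difference by that factor. The case \<open>\<Gamma> = \<Gamma>'\<close> gives uniqueness of the
  stationary law, the general case its Lipschitz dependence on the transition matrix.
\<close>

lemma stationary_law_perturbation:
  fixes \<Gamma> \<Gamma>' :: "real ^ ('q::finite) ^ 'q"
  assumes \<Gamma>: "stochastic \<Gamma>" and \<Gamma>': "stochastic \<Gamma>'" and ge: "\<And>q l. \<delta> \<le> \<Gamma>' $ q $ l"
    and p: "bind_pmf p (transition \<Gamma>) = p" and p': "bind_pmf p' (transition \<Gamma>') = p'"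
  shows "\<delta> * real CARD('q) * (\<Sum>l\<in>UNIV. \<bar>pmf p l - pmf p' l\<bar>)
           \<le> (\<Sum>l\<in>UNIV. \<Sum>q\<in>UNIV. \<bar>\<Gamma> $ q $ l - \<Gamma>' $ q $ l\<bar>)"
proof -
  define d where "d q = pmf p q - pmf p' q" for q
  have d0: "(\<Sum>q\<in>UNIV. d q) = 0"
    by (simp add: d_def sum_subtractf sum_pmf_UNIV)
  have "\<bar>d l\<bar> \<le> (\<Sum>q\<in>UNIV. \<bar>d q\<bar> * (\<Gamma>' $ q $ l - \<delta>)) + (\<Sum>q\<in>UNIV. \<bar>\<Gamma> $ q $ l - \<Gamma>' $ q $ l\<bar>)" for l
  proof -
    have "d l = (\<Sum>q\<in>UNIV. pmf p q * \<Gamma> $ q $ l) - (\<Sum>q\<in>UNIV. pmf p' q * \<Gamma>' $ q $ l)"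
      unfolding d_def using pmf_bind_transition[OF \<Gamma>, of p l] pmf_bind_transition[OF \<Gamma>', of p' l] p p'
      by simp
    also have "\<dots> = (\<Sum>q\<in>UNIV. d q * (\<Gamma>' $ q $ l - \<delta>)) + \<delta> * (\<Sum>q\<in>UNIV. d q)
                     + (\<Sum>q\<in>UNIV. pmf p q * (\<Gamma> $ q $ l - \<Gamma>' $ q $ l))"
      by (simp add: d_def algebra_simps sum.distrib sum_subtractf sum_distrib_left)
    finally have "d l = (\<Sum>q\<in>UNIV. d q * (\<Gamma>' $ q $ l - \<delta>))
                     + (\<Sum>q\<in>UNIV. pmf p q * (\<Gamma> $ q $ l - \<Gamma>' $ q $ l))" using d0 by simp
    also have "\<bar>\<dots>\<bar> \<le> (\<Sum>q\<in>UNIV. \<bar>d q * (\<Gamma>' $ q $ l - \<delta>)\<bar>) + (\<Sum>q\<in>UNIV. \<bar>pmf p q * (\<Gamma> $ q $ l - \<Gamma>' $ q $ l)\<bar>)"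
      by (intro order_trans[OF abs_triangle_ineq] add_mono sum_abs)
    also have "\<dots> \<le> (\<Sum>q\<in>UNIV. \<bar>d q\<bar> * (\<Gamma>' $ q $ l - \<delta>)) + (\<Sum>q\<in>UNIV. \<bar>\<Gamma> $ q $ l - \<Gamma>' $ q $ l\<bar>)"
      by (intro add_mono sum_mono) (auto simp: abs_mult ge pmf_le_1 mult_left_le_one_le)
    finally show ?thesis .
  qed
  then have "(\<Sum>l\<in>UNIV. \<bar>d l\<bar>) \<le> (\<Sum>l\<in>UNIV. \<Sum>q\<in>UNIV. \<bar>d q\<bar> * (\<Gamma>' $ q $ l - \<delta>))
       + (\<Sum>l\<in>UNIV. \<Sum>q\<in>UNIV. \<bar>\<Gamma> $ q $ l - \<Gamma>' $ q $ l\<bar>)"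
    by (simp flip: sum.distrib add: sum_mono)
  also have "(\<Sum>l\<in>UNIV. \<Sum>q\<in>UNIV. \<bar>d q\<bar> * (\<Gamma>' $ q $ l - \<delta>))
      = (\<Sum>q\<in>UNIV. \<bar>d q\<bar>) * (1 - real CARD('q) * \<delta>)"
    using \<Gamma>' unfolding sum_distrib_right
    by (subst sum.swap) (simp add: stochastic_def sum_subtractf flip: sum_distrib_left)
  finally show ?thesis
    unfolding d_def[symmetric] by (simp add: algebra_simps)
qed

text \<open>
  Brouwer's theorem for \<open>v \<mapsto> v \<Gamma>\<close> on the probability simplex.
\<close>

lemma stationary_law_exists:
  fixes \<Gamma> :: "real ^ ('q::finite) ^ 'q"
  assumes "stochastic \<Gamma>"
  shows "\<exists>p. bind_pmf p (transition \<Gamma>) = p"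
proof -
  define S where "S = {v :: real ^ 'q. (\<forall>q. 0 \<le> v $ q) \<and> (\<Sum>q\<in>UNIV. v $ q) = 1}"
  define f :: "real ^ 'q \<Rightarrow> real ^ 'q" where "f v = (\<chi> l. \<Sum>q\<in>UNIV. v $ q * \<Gamma> $ q $ l)" for v
  have S_eq: "S = (\<Inter>q. {v. 0 \<le> v $ q}) \<inter> {v. (\<Sum>q\<in>UNIV. v $ q) = 1}"
    unfolding S_def by auto
  have "closed S" unfolding S_eq
    by (intro closed_Int closed_INT ballI closed_Collect_le closed_Collect_eq continuous_intros)
  moreover have "bounded S"
  proof (rule boundedI)
    fix v assume "v \<in> S"
    then have "norm v \<le> (\<Sum>q\<in>UNIV. \<bar>v $ q\<bar>)" "(\<Sum>q\<in>UNIV. \<bar>v $ q\<bar>) = 1"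
      using norm_le_l1_cart[of v] by (auto simp: S_def)
    then show "norm v \<le> 1" by simp
  qed
  ultimately have "compact S" by (simp add: compact_eq_bounded_closed)
  moreover have "convex S"
    by (rule convexI) (auto simp: S_def sum.distrib simp flip: sum_distrib_left)
  moreover have "(\<chi> q. 1 / real CARD('q)) \<in> S" by (auto simp: S_def)
  then have "S \<noteq> {}" by blast
  moreover have "continuous_on S f"
    unfolding f_def by (intro continuous_intros)
  moreover have "f \<in> S \<rightarrow> S"
  proof (intro funcsetI)
    fix v assume v: "v \<in> S"
    have "(\<Sum>l\<in>UNIV. \<Sum>q\<in>UNIV. v $ q * \<Gamma> $ q $ l) = 1"
      using assms v by (subst sum.swap) (simp add: stochastic_def S_def flip: sum_distrib_left)
    then show "f v \<in> S"
      using assms v by (auto simp: S_def f_def stochastic_def intro!: sum_nonneg)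
  qed
  ultimately obtain v where v: "v \<in> S" "f v = v" using brouwer by blast
  have "(\<integral>\<^sup>+ q. ennreal (v $ q) \<partial>count_space UNIV) = ennreal (\<Sum>q\<in>UNIV. v $ q)"
    using v(1) by (subst nn_integral_count_space_finite) (auto simp: S_def intro!: sum_ennreal)
  then have pmf: "pmf (embed_pmf (\<lambda>q. v $ q)) q = v $ q" for q
    using v(1) by (subst pmf_embed_pmf) (auto simp: S_def)
  have "bind_pmf (embed_pmf (\<lambda>q. v $ q)) (transition \<Gamma>) = embed_pmf (\<lambda>q. v $ q)"
  proof (rule pmf_eqI)
    fix l
    have "v $ l = f v $ l" using v(2) by simp
    then show "pmf (bind_pmf (embed_pmf (\<lambda>q. v $ q)) (transition \<Gamma>)) l = pmf (embed_pmf (\<lambda>q. v $ q)) l"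
      unfolding pmf_bind_transition[OF assms] pmf f_def by simp
  qed
  then show ?thesis by blast
qed

lemma bind_stationary_law:
  fixes \<Gamma> :: "real ^ ('q::finite) ^ 'q"
  assumes \<Gamma>: "stochastic \<Gamma>" and ge: "\<And>q l. \<delta> \<le> \<Gamma> $ q $ l" and "0 < \<delta>"
  shows "bind_pmf (stationary_law \<Gamma>) (transition \<Gamma>) = stationary_law \<Gamma>"
  unfolding stationary_law_def
proof (rule theI')
  show "\<exists>!p. bind_pmf p (transition \<Gamma>) = p"
  proof (rule ex_ex1I)
    fix p p' assume "bind_pmf p (transition \<Gamma>) = p" "bind_pmf p' (transition \<Gamma>) = p'"
    from stationary_law_perturbation[OF \<Gamma> \<Gamma> ge this]
    have "(\<Sum>l\<in>UNIV. \<bar>pmf p l - pmf p' l\<bar>) \<le> 0" using \<open>0 < \<delta>\<close> by (simp add: mult_le_0_iff)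
    then have "(\<Sum>l\<in>UNIV. \<bar>pmf p l - pmf p' l\<bar>) = 0" by (intro antisym sum_nonneg) auto
    then have "\<forall>l. \<bar>pmf p l - pmf p' l\<bar> = 0" by (subst (asm) sum_nonneg_eq_0_iff) auto
    then show "p = p'" by (intro pmf_eqI) auto
  qed (rule stationary_law_exists[OF \<Gamma>])
qed

lemma pmf_stationary_law_ge:
  fixes \<Gamma> :: "real ^ ('q::finite) ^ 'q"
  assumes \<Gamma>: "stochastic \<Gamma>" and ge: "\<And>q l. \<delta> \<le> \<Gamma> $ q $ l" and "0 < \<delta>"
  shows "\<delta> \<le> pmf (stationary_law \<Gamma>) l"
proof -
  have "\<delta> = (\<Sum>q\<in>UNIV. pmf (stationary_law \<Gamma>) q * \<delta>)"
    by (simp add: sum_pmf_UNIV flip: sum_distrib_right)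
  also have "\<dots> \<le> (\<Sum>q\<in>UNIV. pmf (stationary_law \<Gamma>) q * \<Gamma> $ q $ l)"
    by (intro sum_mono mult_left_mono ge) auto
  also have "\<dots> = pmf (stationary_law \<Gamma>) l"
    by (simp add: bind_stationary_law[OF assms] flip: pmf_bind_transition[OF \<Gamma>])
  finally show ?thesis .
qed

text \<open>
  Needed because the likelihood depends on \<open>\<Gamma>\<close> also through the initial law; continuity of the
  objective is what makes its maximum attained.
\<close>

lemma continuous_on_stationary_law:
  assumes "0 < \<delta>"
  shows "continuous_on {\<Gamma> :: real ^ ('q::finite) ^ 'q. stochastic \<Gamma> \<and> (\<forall>q l. \<delta> \<le> \<Gamma> $ q $ l)}
           (\<lambda>\<Gamma>. pmf (stationary_law \<Gamma>) l)"
  unfolding continuous_on_def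
proof
  let ?S = "{\<Gamma> :: real ^ 'q ^ 'q. stochastic \<Gamma> \<and> (\<forall>q l. \<delta> \<le> \<Gamma> $ q $ l)}"
  fix \<Gamma>' assume \<Gamma>': "\<Gamma>' \<in> ?S"
  define b where "b \<Gamma> = (\<Sum>l\<in>UNIV. \<Sum>q\<in>UNIV. \<bar>\<Gamma> $ q $ l - \<Gamma>' $ q $ l\<bar>) / (\<delta> * real CARD('q))" for \<Gamma> :: "real ^ 'q ^ 'q"
  have pos: "\<delta> * real CARD('q) > 0" using assms by simp
  have "(b \<longlongrightarrow> b \<Gamma>') (at \<Gamma>' within ?S)"
    unfolding b_def by (intro tendsto_intros) (use pos in auto)
  then have b: "(b \<longlongrightarrow> 0) (at \<Gamma>' within ?S)" by (simp add: b_def)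
  have "norm (pmf (stationary_law \<Gamma>) l - pmf (stationary_law \<Gamma>') l) \<le> b \<Gamma>" if "\<Gamma> \<in> ?S" for \<Gamma>
  proof -
    have "\<bar>pmf (stationary_law \<Gamma>) l - pmf (stationary_law \<Gamma>') l\<bar>
        \<le> (\<Sum>l\<in>UNIV. \<bar>pmf (stationary_law \<Gamma>) l - pmf (stationary_law \<Gamma>') l\<bar>)"
      by (rule member_le_sum) auto
    also have "\<dots> \<le> b \<Gamma>"
      using stationary_law_perturbation[of \<Gamma> \<Gamma>' \<delta> "stationary_law \<Gamma>" "stationary_law \<Gamma>'"] that \<Gamma>' assms pos
      by (simp add: b_def bind_stationary_law[where \<delta>=\<delta>] pos_le_divide_eq mult.commute)
    finally show ?thesis by simp
  qed
  then have "((\<lambda>\<Gamma>. pmf (stationary_law \<Gamma>) l - pmf (stationary_law \<Gamma>') l) \<longlongrightarrow> 0) (at \<Gamma>' within ?S)"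
    by (intro Lim_null_comparison[OF _ b]) (auto simp: eventually_at_filter)
  then show "((\<lambda>\<Gamma>. pmf (stationary_law \<Gamma>) l) \<longlongrightarrow> pmf (stationary_law \<Gamma>') l) (at \<Gamma>' within ?S)"
    by (simp add: LIM_zero_iff)
qed

section \<open>Laws of Markov paths\<close>

definition paths :: "nat \<Rightarrow> (nat \<Rightarrow> 'q) set" where
  "paths T = PiE_dflt {1..T} undefined (\<lambda>_. UNIV)"

lemma finite_paths: "finite (paths T :: (nat \<Rightarrow> 'q::finite) set)"
  unfolding paths_def by (rule finite_PiE_dflt) auto

lemma pathsD: "z \<in> paths T \<Longrightarrow> t = 0 \<or> T < t \<Longrightarrow> z t = undefined"
  by (auto simp: paths_def PiE_dflt_def)

lemma paths_Suc_upd: "z \<in> paths T \<Longrightarrow> z(Suc T := q) \<in> paths (Suc T)"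
  by (auto simp: paths_def PiE_dflt_def)

lemma paths_upd_undefined: "z \<in> paths (Suc T) \<Longrightarrow> z(Suc T := undefined) \<in> paths T"
  by (auto simp: paths_def PiE_dflt_def)

lemma set_markov_chain: "set_pmf (markov_chain p K T) \<subseteq> paths T"
proof (induction T)
  case 0
  then show ?case by (auto simp: paths_def PiE_dflt_def)
next
  case (Suc T)
  then show ?case by (auto intro: paths_Suc_upd)
qed

lemma markov_chain_Suc_map:
  "markov_chain p K (Suc T) = markov_chain p K T \<bind>
     (\<lambda>z. map_pmf (\<lambda>q. z(Suc T := q)) (if T = 0 then p else K T (z T)))"
  by (simp add: map_pmf_def)

text \<open>
  A path over \<open>{1..Suc T}\<close> has exactly one possible past, its restriction to \<open>{1..T}\<close>, so only one
  term of the mixture defining the chain contributes.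
\<close>

lemma pmf_markov_chain_Suc:
  assumes z: "z \<in> paths (Suc T)"
  shows "pmf (markov_chain p K (Suc T)) z
           = pmf (markov_chain p K T) (z(Suc T := undefined)) * pmf (if T = 0 then p else K T (z T)) (z (Suc T))"
proof -
  \<comment> \<open>The only past of \<open>z\<close>; beyond \<open>T\<close> a path over \<open>{1..T}\<close> is \<open>undefined\<close>.\<close>
  define w0 where "w0 = z(Suc T := undefined)"
  define k where "k w = (if T = 0 then p else K T (w T))" for w :: "nat \<Rightarrow> 'a"
  have inj: "inj (\<lambda>q. w(Suc T := q))" for w :: "nat \<Rightarrow> 'a"
    by (rule injI) (metis fun_upd_same)
  have zero: "pmf (map_pmf (\<lambda>q. w(Suc T := q)) (k w)) z = 0" if "w \<in> set_pmf (markov_chain p K T)" "w \<noteq> w0" for w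
  proof (rule pmf_map_outside)
    have "w (Suc T) = undefined" using that set_markov_chain[of p K T] by (auto dest: pathsD)
    then show "z \<notin> (\<lambda>q. w(Suc T := q)) ` set_pmf (k w)" using \<open>w \<noteq> w0\<close> unfolding w0_def
      by (metis (no_types, lifting) fun_upd_triv fun_upd_upd imageE)
  qed
  have eq: "pmf (map_pmf (\<lambda>q. w0(Suc T := q)) (k w0)) z = pmf (k w0) (z (Suc T))"
    using pmf_map_inj'[OF inj, of w0 "k w0" "z (Suc T)"] by (simp add: w0_def)
  have "pmf (markov_chain p K (Suc T)) z
      = measure_pmf.expectation (markov_chain p K T) (\<lambda>w. pmf (map_pmf (\<lambda>q. w(Suc T := q)) (k w)) z)"
    unfolding markov_chain_Suc_map pmf_bind k_def ..
  also have "\<dots> = pmf (k w0) (z (Suc T)) * pmf (markov_chain p K T) w0"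
    using zero by (subst integral_measure_pmf_real[of "{w0}"]) (auto simp: eq)
  finally show ?thesis by (simp add: k_def w0_def)
qed

lemma pmf_markov_chain:
  assumes "z \<in> paths T"
  shows "pmf (markov_chain p K T) z
           = (\<Prod>t<T. if t = 0 then pmf p (z 1) else pmf (K t (z t)) (z (Suc t)))"
  using assms
proof (induction T arbitrary: z)
  case 0
  then show ?case by (auto simp: paths_def PiE_dflt_def indicator_def)
next
  case (Suc T)
  show ?case
    unfolding pmf_markov_chain_Suc[OF Suc.prems] Suc.IH[OF paths_upd_undefined[OF Suc.prems]]
    by (auto intro!: prod.cong)
qed

lemma map_markov_chain_Suc:
  assumes "\<And>z q. g (z(Suc T := q)) = g z"
  shows "map_pmf g (markov_chain p K (Suc T)) = map_pmf g (markov_chain p K T)"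
  by (simp add: map_bind_pmf assms) (simp add: map_pmf_def)

text \<open>
  Every step, the initial one included, hits each state with probability at least \<open>\<delta>\<close> whatever
  the past, and later steps do not alter the coordinate \<open>t\<close>.
\<close>

lemma markov_chain_marginal_ge:
  assumes p: "\<And>q. \<delta> \<le> pmf p q" and K: "\<And>t q l. \<delta> \<le> pmf (K t q) l" and t: "t \<in> {1..T}"
  shows "\<delta> \<le> measure_pmf.prob (markov_chain p K T) {z. z t = q}"
  using t
proof (induction T)
  case (Suc T)
  have prob: "measure_pmf.prob M {z. z t = q} = pmf (map_pmf (\<lambda>z. z t) M) q" for M :: "(nat \<Rightarrow> 'a) pmf"
    by (simp add: pmf_map vimage_def)
  show ?case
  proof (cases "t = Suc T")
    case False
    then show ?thesis using Suc by (auto simp: prob map_markov_chain_Suc simp del: markov_chain.simps)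
  next
    case True
    have "map_pmf (\<lambda>z. z t) (markov_chain p K (Suc T))
        = markov_chain p K T \<bind> (\<lambda>z. if T = 0 then p else K T (z T))"
      by (simp add: True map_bind_pmf bind_return_pmf')
    then have "measure_pmf.prob (markov_chain p K (Suc T)) {z. z t = q}
        = measure_pmf.expectation (markov_chain p K T) (\<lambda>z. pmf (if T = 0 then p else K T (z T)) q)"
      by (simp add: prob pmf_bind)
    also have "\<dots> \<ge> measure_pmf.expectation (markov_chain p K T) (\<lambda>z. \<delta>)"
      using p K by (intro integral_mono measure_pmf.integrable_const
          measure_pmf.integrable_const_bound[where B=1 and f="\<lambda>z. pmf (_ z) q"]) (auto simp: pmf_le_1)
    finally show ?thesis by simp
  qed
qed simp

text \<open>
  Chain rule for the joint law of a random variable and a second one drawn conditionally on it.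
\<close>

lemma pmf_bind_Pair: "pmf (p \<bind> (\<lambda>x. map_pmf (Pair x) (k x))) (x, y) = pmf p x * pmf (k x) y"
proof -
  have "pmf (map_pmf (Pair x) (k x)) (x, y) = pmf (k x) y"
    by (rule pmf_map_inj') (auto simp: inj_def)
  moreover have "pmf (map_pmf (Pair x') (k x')) (x, y) = 0" if "x' \<noteq> x" for x'
    using that by (intro pmf_map_outside) auto
  ultimately show ?thesis
    by (subst pmf_bind, subst integral_measure_pmf_real[of "{x}"]) (auto simp: mult.commute)
qed

text \<open>
  A transition law is the ratio of a pair probability to a marginal one wherever the marginal does
  not vanish, and its values at states of probability zero do not affect the law of the path. Hence
  one-time and two-time marginals determine the law of a Markov chain, homogeneous or not.
\<close>

lemma markov_chain_eqI:
  assumes "\<And>t. t \<in> {1..T} \<Longrightarrow>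
      map_pmf (\<lambda>z. z t) (markov_chain p K T) = map_pmf (\<lambda>z. z t) (markov_chain p' K' T)"
    and "\<And>t. t \<in> {1..<T} \<Longrightarrow>
      map_pmf (\<lambda>z. (z t, z (Suc t))) (markov_chain p K T) = map_pmf (\<lambda>z. (z t, z (Suc t))) (markov_chain p' K' T)"
  shows "markov_chain p K T = markov_chain p' K' T"
  using assms
proof (induction T)
  case (Suc T)
  have IH: "markov_chain p K T = markov_chain p' K' T"
  proof (rule Suc.IH)
    fix t assume t: "t \<in> {1..T}"
    then show "map_pmf (\<lambda>z. z t) (markov_chain p K T) = map_pmf (\<lambda>z. z t) (markov_chain p' K' T)"
      using Suc.prems(1)[of t] by (simp add: map_markov_chain_Suc del: markov_chain.simps)
  next
    fix t assume t: "t \<in> {1..<T}"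
    then show "map_pmf (\<lambda>z. (z t, z (Suc t))) (markov_chain p K T) = map_pmf (\<lambda>z. (z t, z (Suc t))) (markov_chain p' K' T)"
      using Suc.prems(2)[of t] by (simp add: map_markov_chain_Suc del: markov_chain.simps)
  qed
  show ?case
  proof (cases "T = 0")
    case True
    have "map_pmf (\<lambda>z. z 1) (markov_chain p K 1) = p" for p :: "'a pmf" and K
      by (simp add: bind_return_pmf map_bind_pmf bind_return_pmf')
    then have "p = p'" using Suc.prems(1)[of 1] True by simp
    then show ?thesis by (simp add: True)
  next
    case False
    define m where "m = map_pmf (\<lambda>z. z T) (markov_chain p' K' T)"
    have pair: "pmf (map_pmf (\<lambda>z. (z T, z (Suc T))) (markov_chain r L (Suc T))) (q, l)
        = pmf (map_pmf (\<lambda>z. z T) (markov_chain r L T)) q * pmf (L T q) l" for r :: "'a pmf" and L q l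
    proof -
      have "map_pmf (\<lambda>z. (z T, z (Suc T))) (markov_chain r L (Suc T))
          = map_pmf (\<lambda>z. z T) (markov_chain r L T) \<bind> (\<lambda>q. map_pmf (Pair q) (L T q))"
        using False by (simp add: map_bind_pmf bind_map_pmf) (simp add: map_pmf_def)
      then show ?thesis by (simp only: pmf_bind_Pair)
    qed
    have K: "K T q = K' T q" if "q \<in> set_pmf m" for q
    proof (rule pmf_eqI)
      fix l
      have "pmf m q * pmf (K T q) l = pmf m q * pmf (K' T q) l"
        using pair[of p K q l] pair[of p' K' q l] Suc.prems(2)[of T] False IH
        by (auto simp: m_def simp del: markov_chain.simps)
      then show "pmf (K T q) l = pmf (K' T q) l" using that by (simp add: set_pmf_iff)
    qed
    show ?thesis unfolding markov_chain_Suc_map IH using False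
      by (intro bind_pmf_cong refl) (auto simp: m_def intro!: arg_cong2[where f=map_pmf] K)
  qed
qed simp

lemma markov_chain_return:
  "markov_chain (return_pmf (z 1)) (\<lambda>t _. return_pmf (z (Suc t))) T
     = return_pmf (\<lambda>t. if t \<in> {1..T} then z t else undefined)"
proof (induction T)
  case (Suc T)
  show ?case
    unfolding markov_chain.simps Suc.IH
    by (auto simp: bind_return_pmf fun_eq_iff)
qed simp

section \<open>Likelihood of the dynamic block model\<close>

definition labellings :: "nat \<Rightarrow> nat \<Rightarrow> 'q labelling set" where
  "labellings n T = PiE_dflt {1..n} (\<lambda>_. undefined) (\<lambda>_. paths T)"

lemma finite_labellings: "finite (labellings n T :: 'q::finite labelling set)"
  unfolding labellings_def by (rule finite_PiE_dflt) (auto intro: finite_paths)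

lemma labellings_paths: "Z \<in> labellings n T \<Longrightarrow> i \<in> {1..n} \<Longrightarrow> Z i \<in> paths T"
  by (auto simp: labellings_def PiE_dflt_def)

lemma set_Pi_markov_chain:
  "set_pmf (Pi_pmf {1..n} (\<lambda>_. undefined) (\<lambda>i. markov_chain (p i) (K i) T)) \<subseteq> labellings n T"
  using set_markov_chain by (subst set_Pi_pmf) (fastforce simp: labellings_def PiE_dflt_def)+

lemma finite_dyads: "finite (dyads n T)"
  by (rule finite_subset[of _ "{1..T} \<times> {1..n} \<times> {1..n}"]) (auto simp: dyads_def)

lemma set_observation_law: "set_pmf (observation_law n T \<pi> Z) \<subseteq> adjacencies n T"
proof -
  have "symmetrize e \<in> adjacencies n T" if "\<And>d. d \<notin> dyads n T \<Longrightarrow> \<not> e d" for e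
    using that unfolding adjacencies_def symmetrize_def
    by (auto simp: dyads_def split: if_splits)
  moreover have "\<not> e d" if "e \<in> set_pmf (Pi_pmf (dyads n T) False p)" "d \<notin> dyads n T" for e d p
    using that set_Pi_pmf_subset[OF finite_dyads, of n T False p] by blast
  ultimately show ?thesis
    unfolding observation_law_def set_map_pmf by (intro image_subsetI) blast
qed

lemma pmf_observation_law:
  assumes X: "X \<in> adjacencies n T" and \<pi>: "\<And>q l. 0 < \<pi> $ q $ l \<and> \<pi> $ q $ l < 1"
  shows "pmf (observation_law n T \<pi> Z) X
           = (\<Prod>(t, i, j)\<in>dyads n T. if X t i j then \<pi> $ Z i t $ Z j t else 1 - \<pi> $ Z i t $ Z j t)"
proof -
  define e where "e = (\<lambda>(t, i, j). (t, i, j) \<in> dyads n T \<and> X t i j)"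
  define M where "M = Pi_pmf (dyads n T) False (\<lambda>(t, i, j). bernoulli_pmf (\<pi> $ Z i t $ Z j t))"
  have "symmetrize e t i j = X t i j" for t i j
    using X unfolding adjacencies_def symmetrize_def e_def
    by (auto simp: dyads_def)
  then have X_eq: "X = symmetrize e" by (simp add: fun_eq_iff)
  have "pmf M e = (\<Prod>d\<in>dyads n T. pmf (case d of (t, i, j) \<Rightarrow> bernoulli_pmf (\<pi> $ Z i t $ Z j t)) (e d))"
    unfolding M_def by (rule pmf_Pi') (auto simp: finite_dyads e_def)
  also have "\<dots> = (\<Prod>(t, i, j)\<in>dyads n T. if X t i j then \<pi> $ Z i t $ Z j t else 1 - \<pi> $ Z i t $ Z j t)"
    using \<pi> by (intro prod.cong refl) (auto simp: e_def less_imp_le)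
  finally have pmf_e: "pmf M e = \<dots>" .
  also have "\<dots> > 0" using \<pi> by (intro prod_pos) auto
  finally have "e \<in> set_pmf M" by (auto simp: set_pmf_iff)
  moreover have "inj_on symmetrize (set_pmf M)"
  proof (rule inj_onI)
    fix d d' assume d: "d \<in> set_pmf M" "d' \<in> set_pmf M" "symmetrize d = symmetrize d'"
    have "d (t, i, j) = d' (t, i, j)" for t i j
    proof (cases "(t, i, j) \<in> dyads n T")
      case True
      then show ?thesis
        using fun_cong[OF fun_cong[OF fun_cong[OF d(3)]], of t i j] by (simp add: symmetrize_def dyads_def)
    next
      case False
      then show ?thesis using d(1,2) set_Pi_pmf_subset[OF finite_dyads, of n T False]
        unfolding M_def by blast
    qed
    then show "d = d'" by (simp add: fun_eq_iff)
  qed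
  ultimately have "pmf (map_pmf symmetrize M) (symmetrize e) = pmf M e" by (intro pmf_map_inj)
  then show ?thesis unfolding observation_law_def M_def[symmetric] X_eq[symmetric] pmf_e .
qed

lemma dsbm_bind_Pair:
  "dsbm n T \<theta> = label_law n T (fst \<theta>) \<bind> (\<lambda>Z. map_pmf (Pair Z) (observation_law n T (snd \<theta>) Z))"
  by (simp add: dsbm_def map_pmf_def)

lemma pmf_dsbm:
  "pmf (dsbm n T \<theta>) (Z, X) = pmf (label_law n T (fst \<theta>)) Z * pmf (observation_law n T (snd \<theta>) Z) X"
  unfolding dsbm_bind_Pair by (rule pmf_bind_Pair)

lemma set_dsbm: "set_pmf (dsbm n T \<theta>) \<subseteq> labellings n T \<times> adjacencies n T"
  using set_Pi_markov_chain[of n] set_observation_law[of n T]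
  unfolding dsbm_bind_Pair label_law_def by fastforce

lemma ParamsD:
  assumes "\<theta> \<in> Params \<delta> \<zeta>"
  shows "stochastic (fst \<theta>)" "\<delta> \<le> fst \<theta> $ q $ l" "\<zeta> \<le> snd \<theta> $ q $ l" "snd \<theta> $ q $ l \<le> 1 - \<zeta>"
  using assms by (auto simp: Params_def)

lemma Params_symmetric: "\<theta> \<in> Params \<delta> \<zeta> \<Longrightarrow> snd \<theta> $ q $ l = snd \<theta> $ l $ q"
proof -
  assume "\<theta> \<in> Params \<delta> \<zeta>"
  then have "transpose (snd \<theta>) = snd \<theta>" by (auto simp: Params_def)
  then have "transpose (snd \<theta>) $ q $ l = snd \<theta> $ q $ l" by simp
  then show ?thesis by (simp add: transpose_def)
qed

lemma labellings_nonempty: "labellings n T \<noteq> ({} :: 'q labelling set)"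
  by (auto simp: labellings_def paths_def)

lemma pmf_observation_marginal:
  fixes \<theta> :: "('q::finite) param"
  shows "pmf (map_pmf snd (dsbm n T \<theta>)) X = (\<Sum>Z\<in>labellings n T. pmf (dsbm n T \<theta>) (Z, X))"
proof -
  have "pmf (map_pmf snd (dsbm n T \<theta>)) X = measure_pmf.prob (dsbm n T \<theta>) ((\<lambda>Z. (Z, X)) ` labellings n T)"
    unfolding pmf_map using set_dsbm[of n T \<theta>]
    by (intro measure_prob_cong_0) (auto simp: set_pmf_iff)
  also have "\<dots> = (\<Sum>Z\<in>labellings n T. pmf (dsbm n T \<theta>) (Z, X))"
    by (subst measure_measure_pmf_finite) (auto simp: finite_labellings sum.reindex inj_on_def)
  finally show ?thesis .
qed

context
  fixes \<delta> \<zeta> :: real and n T :: nat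
  assumes \<delta>: "0 < \<delta>" and \<zeta>: "0 < \<zeta>"
begin

lemma pmf_label_law:
  assumes "\<theta> \<in> Params \<delta> \<zeta>" "Z \<in> labellings n T"
  shows "pmf (label_law n T (fst \<theta>)) Z = (\<Prod>i=1..n. \<Prod>t<T.
           if t = 0 then pmf (stationary_law (fst \<theta>)) (Z i 1) else fst \<theta> $ Z i t $ Z i (Suc t))"
proof -
  have "pmf (label_law n T (fst \<theta>)) Z
      = (\<Prod>i\<in>{1..n}. pmf (markov_chain (stationary_law (fst \<theta>)) (\<lambda>_. transition (fst \<theta>)) T) (Z i))"
    unfolding label_law_def
    by (rule pmf_Pi') (use assms in \<open>auto simp: labellings_def PiE_dflt_def\<close>)
  then show ?thesis
    using assms by (auto simp: pmf_markov_chain labellings_paths pmf_transition[OF ParamsD(1)[OF assms(1)]]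
        intro!: prod.cong)
qed

lemma pmf_label_law_ge:
  assumes "\<theta> \<in> Params \<delta> \<zeta>" "Z \<in> labellings n T"
  shows "\<delta> ^ (n * T) \<le> pmf (label_law n T (fst \<theta>)) Z"
proof -
  have "\<delta> ^ (n * T) = (\<Prod>i=1..n. \<Prod>t<T. \<delta>)" by (simp add: power_mult[symmetric] mult.commute)
  also have "\<dots> \<le> pmf (label_law n T (fst \<theta>)) Z"
    unfolding pmf_label_law[OF assms]
    using \<delta> assms by (intro prod_mono conjI prod_nonneg) (auto intro!: pmf_stationary_law_ge ParamsD[OF assms(1)])
  finally show ?thesis .
qed

lemma pmf_observation_law_Params:
  assumes "\<theta> \<in> Params \<delta> \<zeta>" "X \<in> adjacencies n T"
  shows "pmf (observation_law n T (snd \<theta>) Z) X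
           = (\<Prod>(t, i, j)\<in>dyads n T. if X t i j then snd \<theta> $ Z i t $ Z j t else 1 - snd \<theta> $ Z i t $ Z j t)"
proof (intro pmf_observation_law assms(2) conjI)
  fix q l
  show "0 < snd \<theta> $ q $ l" "snd \<theta> $ q $ l < 1"
    using ParamsD(3,4)[OF assms(1), of q l] \<zeta> by auto
qed

lemma pmf_observation_law_pos:
  assumes "\<theta> \<in> Params \<delta> \<zeta>" "X \<in> adjacencies n T"
  shows "0 < pmf (observation_law n T (snd \<theta>) Z) X"
  unfolding pmf_observation_law_Params[OF assms]
proof (intro prod_pos ballI)
  fix d :: "nat \<times> nat \<times> nat"
  obtain t i j where "d = (t, i, j)" by (cases d) auto
  moreover have "0 < snd \<theta> $ Z i t $ Z j t" "0 < 1 - snd \<theta> $ Z i t $ Z j t"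
    using ParamsD(3,4)[OF assms(1), of "Z i t" "Z j t"] \<zeta> by linarith+
  ultimately show "0 < (case d of (t, i, j) \<Rightarrow> if X t i j then snd \<theta> $ Z i t $ Z j t else 1 - snd \<theta> $ Z i t $ Z j t)"
    by simp
qed

lemma pmf_dsbm_pos:
  assumes "\<theta> \<in> Params \<delta> \<zeta>" "Z \<in> labellings n T" "X \<in> adjacencies n T"
  shows "0 < pmf (dsbm n T \<theta>) (Z, X)"
  unfolding pmf_dsbm using \<delta> assms
  by (intro mult_pos_pos pmf_observation_law_pos less_le_trans[OF _ pmf_label_law_ge]) auto

lemma continuous_on_pmf_dsbm:
  assumes "Z \<in> labellings n T" "X \<in> adjacencies n T"
  shows "continuous_on (Params \<delta> \<zeta>) (\<lambda>\<theta> :: ('q::finite) param. pmf (dsbm n T \<theta>) (Z, X))"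
proof -
  have stat: "continuous_on (Params \<delta> \<zeta>) (\<lambda>\<theta> :: 'q param. pmf (stationary_law (fst \<theta>)) q)" for q
    by (rule continuous_on_compose2[OF continuous_on_stationary_law[OF \<delta>]])
       (auto intro!: continuous_intros intro: ParamsD)
  have "continuous_on (Params \<delta> \<zeta>) (\<lambda>\<theta> :: 'q param.
      (\<Prod>i=1..n. \<Prod>t<T. if t = 0 then pmf (stationary_law (fst \<theta>)) (Z i 1) else fst \<theta> $ Z i t $ Z i (Suc t))
      * (\<Prod>d\<in>dyads n T. case d of (t, i, j) \<Rightarrow>
           if X t i j then snd \<theta> $ Z i t $ Z j t else 1 - snd \<theta> $ Z i t $ Z j t))"
  proof (intro continuous_on_mult continuous_on_prod)
    fix i t
    show "continuous_on (Params \<delta> \<zeta>) (\<lambda>\<theta> :: 'q param.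
        if t = 0 then pmf (stationary_law (fst \<theta>)) (Z i 1) else fst \<theta> $ Z i t $ Z i (Suc t))"
      by (cases "t = 0") (simp_all add: stat, (intro continuous_intros)+)
  next
    fix d :: "nat \<times> nat \<times> nat"
    obtain t i j where "d = (t, i, j)" by (cases d) auto
    then show "continuous_on (Params \<delta> \<zeta>) (\<lambda>\<theta> :: 'q param. case d of (t, i, j) \<Rightarrow>
           if X t i j then snd \<theta> $ Z i t $ Z j t else 1 - snd \<theta> $ Z i t $ Z j t)"
      by (cases "X t i j") (simp_all, (intro continuous_intros)+)
  qed
  then show ?thesis
    by (rule continuous_on_eq)
       (auto simp: pmf_dsbm pmf_label_law pmf_observation_law_Params assms)
qed

lemma pmf_observation_marginal_pos:
  fixes \<theta> :: "('q::finite) param"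
  assumes "\<theta> \<in> Params \<delta> \<zeta>" "X \<in> adjacencies n T"
  shows "0 < pmf (map_pmf snd (dsbm n T \<theta>)) X"
  unfolding pmf_observation_marginal using assms
  by (intro sum_pos finite_labellings pmf_dsbm_pos labellings_nonempty)

lemma pmf_posterior:
  fixes \<theta> :: "('q::finite) param"
  assumes "\<theta> \<in> Params \<delta> \<zeta>" "X \<in> adjacencies n T"
  shows "pmf (posterior n T X \<theta>) Z = pmf (dsbm n T \<theta>) (Z, X) / pmf (map_pmf snd (dsbm n T \<theta>)) X"
proof -
  define E where "E = {(Z :: 'q labelling, X'). X' = X}"
  have E: "E = snd -` {X}" by (auto simp: E_def)
  have "measure_pmf.prob (dsbm n T \<theta>) E > 0"
    using pmf_observation_marginal_pos[OF assms] by (simp add: E pmf_map)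
  then have ne: "set_pmf (dsbm n T \<theta>) \<inter> E \<noteq> {}"
    by (metis measure_pmf_zero_iff less_irrefl)
  have "pmf (posterior n T X \<theta>) Z = measure_pmf.prob (cond_pmf (dsbm n T \<theta>) E) {(Z, X)}"
    unfolding posterior_def E_def[symmetric] pmf_map
    by (rule measure_prob_cong_0) (auto simp: pmf_cond[OF ne], auto simp: E_def)
  also have "\<dots> = pmf (dsbm n T \<theta>) (Z, X) / measure_pmf.prob (dsbm n T \<theta>) E"
    by (simp add: measure_pmf_single pmf_cond[OF ne]) (simp add: E_def)
  finally show ?thesis by (simp add: E pmf_map)
qed

end

text \<open>
  The density of \<open>q\<close> with respect to \<open>p\<close> is the quotient of the mass functions; where \<open>p\<close> vanishes
  so does \<open>q\<close>, and the quotient is 0 there.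
\<close>

lemma KL_divergence_pmf:
  assumes "finite A" "set_pmf q \<subseteq> A" "set_pmf q \<subseteq> set_pmf p"
  shows "KL_divergence (exp 1) (measure_pmf p) (measure_pmf q) = (\<Sum>x\<in>A. pmf q x * ln (pmf q x / pmf p x))"
proof -
  define f where "f x = pmf q x / pmf p x" for x
  have f: "pmf p x * f x = pmf q x" for x
    using assms(3) by (cases "pmf p x = 0") (auto simp: f_def set_pmf_iff)
  have f_nonneg: "0 \<le> f x" for x by (simp add: f_def)
  have "measure_pmf q = density (measure_pmf p) f"
    by (subst (1 2) measure_pmf_eq_density) (simp add: density_density_eq f f_nonneg flip: ennreal_mult)
  then have "KL_divergence (exp 1) (measure_pmf p) (measure_pmf q)
      = measure_pmf.expectation p (\<lambda>x. f x * log (exp 1) (f x))"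
    using sigma_finite_measure.KL_density[OF measure_pmf.sigma_finite_measure_axioms[of p], where f=f and b="exp 1"] by (simp add: f_def)
  also have "\<dots> = (\<Sum>x\<in>A. f x * log (exp 1) (f x) * pmf p x)"
    using assms by (subst integral_measure_pmf_real[of A]) (auto simp: f_def set_pmf_iff)
  also have "\<dots> = (\<Sum>x\<in>A. pmf q x * ln (f x))"
    by (intro sum.cong refl) (simp add: log_def mult.commute mult.left_commute flip: f)
  finally show ?thesis by (simp add: f_def)
qed

text \<open>
  From \<open>ln x \<le> x - 1\<close>.
\<close>

lemma gibbs_inequality:
  assumes "finite A" "set_pmf q \<subseteq> A" "set_pmf q \<subseteq> set_pmf p"
  shows "0 \<le> (\<Sum>x\<in>A. pmf q x * ln (pmf q x / pmf p x))"
proof -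
  have "pmf q x - pmf p x \<le> pmf q x * ln (pmf q x / pmf p x)" for x
  proof (cases "pmf q x = 0")
    case False
    then have pos: "0 < pmf q x" "0 < pmf p x" using assms(3) by (auto simp: set_pmf_iff order_less_le)
    then have "ln (pmf p x / pmf q x) \<le> pmf p x / pmf q x - 1" by (intro ln_le_minus_one) auto
    then have "pmf q x * ln (pmf p x / pmf q x) \<le> pmf p x - pmf q x"
      using mult_left_mono[of _ _ "pmf q x"] pos by (fastforce simp: field_simps)
    with pos show ?thesis by (simp add: ln_div right_diff_distrib)
  qed simp
  then have "(\<Sum>x\<in>A. pmf q x - pmf p x) \<le> (\<Sum>x\<in>A. pmf q x * ln (pmf q x / pmf p x))"
    by (rule sum_mono)
  moreover have "(\<Sum>x\<in>A. pmf q x) = 1" using assms by (intro sum_pmf_eq_1)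
  moreover have "(\<Sum>x\<in>A. pmf p x) \<le> 1"
    using assms(1) by (simp flip: measure_measure_pmf_finite)
  ultimately show ?thesis by (simp add: sum_subtractf)
qed

section \<open>The variational objective between complete and marginal likelihood\<close>

lemma prob_coordinate: "measure_pmf.prob D {x. g x = y} = pmf (map_pmf g D) y"
  by (simp add: pmf_map vimage_def)

text \<open>
  This turns the definite description in \<^const>\<open>variational_law\<close> into an actual law: the nodes are
  independent and each path law is determined by \<open>\<tau>\<close> and \<open>\<eta>\<close>.
\<close>

lemma variational_law_unique:
  assumes D: "is_variational_law n T chi D" and D': "is_variational_law n T chi D'"
  shows "D = D'"
proof -
  obtain p K where D_eq: "D = Pi_pmf {1..n} (\<lambda>_. undefined) (\<lambda>i. markov_chain (p i) (K i) T)"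
    using D by (auto simp: is_variational_law_def)
  obtain p' K' where D'_eq: "D' = Pi_pmf {1..n} (\<lambda>_. undefined) (\<lambda>i. markov_chain (p' i) (K' i) T)"
    using D' by (auto simp: is_variational_law_def)
  have "markov_chain (p i) (K i) T = markov_chain (p' i) (K' i) T" if i: "i \<in> {1..n}" for i
  proof -
    have node: "map_pmf (\<lambda>Z. Z i) D = markov_chain (p i) (K i) T"
         "map_pmf (\<lambda>Z. Z i) D' = markov_chain (p' i) (K' i) T"
      unfolding D_eq D'_eq using i by (auto simp: Pi_pmf_component)
    have single: "pmf (map_pmf (\<lambda>Z. Z i t) E) q = fst chi t i q"
      if "is_variational_law n T chi E" "t \<in> {1..T}" for E t q
      using that i by (auto simp: is_variational_law_def simp flip: prob_coordinate)
    have pair: "pmf (map_pmf (\<lambda>Z. (Z i t, Z i (Suc t))) E) (q, l) = snd chi t i q l"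
      if "is_variational_law n T chi E" "t \<in> {1..<T}" for E t q l
      using that i by (auto simp: is_variational_law_def simp flip: prob_coordinate)
    show ?thesis
    proof (rule markov_chain_eqI)
      fix t assume "t \<in> {1..T}"
      then show "map_pmf (\<lambda>z. z t) (markov_chain (p i) (K i) T) = map_pmf (\<lambda>z. z t) (markov_chain (p' i) (K' i) T)"
        unfolding node[symmetric] pmf.map_comp o_def using single[OF D] single[OF D'] by (intro pmf_eqI) simp
    next
      fix t assume "t \<in> {1..<T}"
      then show "map_pmf (\<lambda>z. (z t, z (Suc t))) (markov_chain (p i) (K i) T)
          = map_pmf (\<lambda>z. (z t, z (Suc t))) (markov_chain (p' i) (K' i) T)"
        unfolding node[symmetric] pmf.map_comp o_def using pair[OF D] pair[OF D'] by (intro pmf_eqI) auto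
    qed
  qed
  then show ?thesis unfolding D_eq D'_eq by (intro Pi_pmf_cong) auto
qed

lemma is_variational_law_variational_law:
  assumes "chi \<in> Vparams n T"
  shows "is_variational_law n T chi (variational_law n T chi)"
proof -
  obtain D where "is_variational_law n T chi D" using assms by (auto simp: Vparams_def)
  then show ?thesis unfolding variational_law_def by (metis theI variational_law_unique)
qed

lemma set_variational_law:
  assumes "chi \<in> Vparams n T"
  shows "set_pmf (variational_law n T chi) \<subseteq> labellings n T"
proof -
  obtain p K where
    "variational_law n T chi = Pi_pmf {1..n} (\<lambda>_. undefined) (\<lambda>i. markov_chain (p i) (K i) T)"
    using is_variational_law_variational_law[OF assms] unfolding is_variational_law_def by blast
  then show ?thesis by (simp only: set_Pi_markov_chain)
qed

text \<open>
  Point masses belong to the variational family, as chains with deterministic steps. They are the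
  competitors that bound the optimal objective from below.
\<close>

lemma return_pmf_variational:
  assumes "Z \<in> labellings n T"
  obtains chi where "chi \<in> Vparams n T" "variational_law n T chi = return_pmf Z"
proof -
  define D where "D = return_pmf Z"
  define chi where "chi = (\<lambda>t i q. measure_pmf.prob D {Z. Z i t = q},
      \<lambda>t i q l. measure_pmf.prob D {Z. Z i t = q \<and> Z i (Suc t) = l})"
  have "Z = (\<lambda>i. if i \<in> {1..n} then (\<lambda>t. if t \<in> {1..T} then Z i t else undefined) else (\<lambda>_. undefined))"
    using assms by (auto simp: labellings_def paths_def PiE_dflt_def fun_eq_iff)
  then have "D = Pi_pmf {1..n} (\<lambda>_. undefined)
      (\<lambda>i. markov_chain (return_pmf (Z i 1)) (\<lambda>t _. return_pmf (Z i (Suc t))) T)"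
    unfolding D_def markov_chain_return by (subst Pi_pmf_return_pmf) auto
  then have "is_variational_law n T chi D"
    unfolding is_variational_law_def chi_def by auto
  then have "chi \<in> Vparams n T" "variational_law n T chi = D"
    using is_variational_law_variational_law[of chi n T] variational_law_unique[of n T chi _ D]
    unfolding Vparams_def by blast+
  then show ?thesis using that by (simp add: D_def)
qed

context
  fixes \<delta> \<zeta> :: real and n T :: nat and X :: adjacency and \<theta> :: "('q::finite) param"
  assumes \<delta>: "0 < \<delta>" and \<zeta>: "0 < \<zeta>" and \<theta>: "\<theta> \<in> Params \<delta> \<zeta>" and X: "X \<in> adjacencies n T"
begin

lemma set_posterior: "labellings n T \<subseteq> set_pmf (posterior n T X \<theta>)"
  using pmf_dsbm_pos[OF \<delta> \<zeta> \<theta> _ X] pmf_observation_marginal_pos[OF \<delta> \<zeta> \<theta> X]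
  by (fastforce simp: set_pmf_iff pmf_posterior[OF \<delta> \<zeta> \<theta> X])

lemma elbo_KL:
  assumes "chi \<in> Vparams n T"
  defines "D \<equiv> variational_law n T chi"
  shows "elbo n T X chi \<theta> = log_likelihood n T X \<theta>
    - (\<Sum>Z\<in>labellings n T. pmf D Z * ln (pmf D Z / pmf (posterior n T X \<theta>) Z))"
  unfolding elbo_def D_def
  using set_variational_law[OF assms(1)] set_posterior
  by (subst KL_divergence_pmf[OF finite_labellings]) auto

lemma elbo_le_log_likelihood: "chi \<in> Vparams n T \<Longrightarrow> elbo n T X chi \<theta> \<le> log_likelihood n T X \<theta>"
  using gibbs_inequality[OF finite_labellings set_variational_law
      order_trans[OF set_variational_law set_posterior], of chi] elbo_KL[of chi] by linarith

lemma elbo_eq_sum: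
  assumes "chi \<in> Vparams n T"
  defines "D \<equiv> variational_law n T chi"
  shows "elbo n T X chi \<theta>
    = (\<Sum>Z\<in>labellings n T. pmf D Z * (ln (pmf (dsbm n T \<theta>) (Z, X)) - ln (pmf D Z)))"
proof -
  define m where "m = pmf (map_pmf snd (dsbm n T \<theta>)) X"
  have m: "0 < m" unfolding m_def by (rule pmf_observation_marginal_pos[OF \<delta> \<zeta> \<theta> X])
  have "pmf D Z * ln (pmf D Z / pmf (posterior n T X \<theta>) Z)
      = pmf D Z * ln m - pmf D Z * (ln (pmf (dsbm n T \<theta>) (Z, X)) - ln (pmf D Z))" if Z: "Z \<in> labellings n T" for Z
  proof (cases "pmf D Z = 0")
    case False
    then have "0 < pmf D Z" "0 < pmf (dsbm n T \<theta>) (Z, X)"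
      using pmf_dsbm_pos[OF \<delta> \<zeta> \<theta> Z X] by (auto simp: order_less_le)
    then show ?thesis using m
      by (simp add: pmf_posterior[OF \<delta> \<zeta> \<theta> X] ln_div ln_mult flip: m_def) (simp add: algebra_simps)
  qed simp
  then have "(\<Sum>Z\<in>labellings n T. pmf D Z * ln (pmf D Z / pmf (posterior n T X \<theta>) Z))
      = (\<Sum>Z\<in>labellings n T. pmf D Z) * ln m
         - (\<Sum>Z\<in>labellings n T. pmf D Z * (ln (pmf (dsbm n T \<theta>) (Z, X)) - ln (pmf D Z)))"
    by (simp add: sum_subtractf sum_distrib_right)
  moreover have "(\<Sum>Z\<in>labellings n T. pmf D Z) = 1"
    unfolding D_def by (intro sum_pmf_eq_1 finite_labellings set_variational_law assms(1))
  ultimately show ?thesis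
    using elbo_KL[OF assms(1)] by (simp add: D_def m_def log_likelihood_def)
qed

lemma elbo_return_pmf:
  assumes "chi \<in> Vparams n T" "variational_law n T chi = return_pmf Z" "Z \<in> labellings n T"
  shows "elbo n T X chi \<theta> = ln (pmf (dsbm n T \<theta>) (Z, X))"
  unfolding elbo_eq_sum[OF assms(1)] assms(2)
  using assms(3) by (subst sum.remove[of _ Z]) (auto simp: finite_labellings intro!: sum.neutral)

text \<open>
  The marginal likelihood is an average of the conditional likelihoods given the labels, hence at
  most the largest of them.
\<close>

lemma log_likelihood_le_complete:
  obtains Z where "Z \<in> labellings n T"
    "log_likelihood n T X \<theta> \<le> ln (pmf (observation_law n T (snd \<theta>) Z) X)"
proof -
  define P where "P Z = pmf (observation_law n T (snd \<theta>) Z) X" for Z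
  obtain Z where Z: "Z \<in> labellings n T" "\<And>Z'. Z' \<in> labellings n T \<Longrightarrow> P Z' \<le> P Z"
  proof -
    have "Max (P ` labellings n T) \<in> P ` labellings n T"
      by (intro Max_in finite_imageI finite_labellings) (simp add: labellings_nonempty)
    then obtain Z where "Z \<in> labellings n T" "Max (P ` labellings n T) = P Z" by auto
    then show ?thesis
      using that[of Z] Max_ge[OF finite_imageI[OF finite_labellings, of P], of "P _" n T] by simp
  qed
  have "pmf (map_pmf snd (dsbm n T \<theta>)) X \<le> (\<Sum>Z'\<in>labellings n T. pmf (label_law n T (fst \<theta>)) Z' * P Z)"
    unfolding pmf_observation_marginal pmf_dsbm
    using Z(2) by (intro sum_mono mult_left_mono) (auto simp: P_def)
  also have "\<dots> = measure_pmf.prob (label_law n T (fst \<theta>)) (labellings n T) * P Z"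
    by (simp add: measure_measure_pmf_finite[OF finite_labellings] sum_distrib_right)
  also have "\<dots> \<le> P Z" by (simp add: P_def mult_left_le_one_le)
  finally show ?thesis
    using that[OF Z(1)] pmf_observation_marginal_pos[OF \<delta> \<zeta> \<theta> X]
    by (simp add: log_likelihood_def P_def)
qed

end

text \<open>
  Testing the point mass at \<open>Z\<close> costs only the prior probability of \<open>Z\<close>. As all initial and
  transition probabilities are at least \<open>\<delta>\<close>, this is at most \<open>n T ln (1 / \<delta>)\<close> on the logarithmic
  scale, negligible against the \<open>n\<^sup>2 T\<close> terms of the likelihood.
\<close>

lemma elbo_optimal_ge_complete:
  assumes "0 < \<delta>" "0 < \<zeta>" "\<theta> \<in> Params \<delta> \<zeta>" "X \<in> adjacencies n T" "Z \<in> labellings n T"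
    and max: "is_arg_max (\<lambda>chi. elbo n T X chi \<theta>) (\<lambda>chi. chi \<in> Vparams n T) chi"
  shows "ln (pmf (observation_law n T (snd \<theta>) Z) X) - real n * real T * ln (1 / \<delta>) \<le> elbo n T X chi \<theta>"
proof -
  obtain chi' where chi': "chi' \<in> Vparams n T" "variational_law n T chi' = return_pmf Z"
    using return_pmf_variational[OF assms(5)] .
  have pos: "0 < pmf (observation_law n T (snd \<theta>) Z) X" "0 < pmf (label_law n T (fst \<theta>)) Z"
    using pmf_observation_law_pos[OF assms(1-4)] pmf_dsbm_pos[OF assms(1-3,5,4)]
    by (auto simp: pmf_dsbm zero_less_mult_iff)
  have "\<delta> ^ (n * T) \<le> pmf (label_law n T (fst \<theta>)) Z"
    by (rule pmf_label_law_ge[OF assms(1-3,5)])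
  then have "ln (\<delta> ^ (n * T)) \<le> ln (pmf (label_law n T (fst \<theta>)) Z)"
    using assms(1) pos by simp
  then have "- (real n * real T * ln (1 / \<delta>)) \<le> ln (pmf (label_law n T (fst \<theta>)) Z)"
    using assms(1) by (simp add: ln_realpow ln_div)
  then have "ln (pmf (observation_law n T (snd \<theta>) Z) X) - real n * real T * ln (1 / \<delta>)
      \<le> ln (pmf (dsbm n T \<theta>) (Z, X))"
    using pos by (simp add: pmf_dsbm ln_mult)
  also have "\<dots> = elbo n T X chi' \<theta>"
    by (rule elbo_return_pmf[OF assms(1-4) chi' assms(5), symmetric])
  also have "\<dots> \<le> elbo n T X chi \<theta>"
    using max chi'(1) unfolding is_arg_max_linorder by blast
  finally show ?thesis .
qed

text \<open>
  A bound uniform in \<open>chi\<close>: the entropy of the variational law cancels and only an average of the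
  complete log-likelihoods remains.
\<close>

lemma elbo_diff_le:
  fixes \<theta> \<theta>' :: "('q::finite) param"
  assumes "0 < \<delta>" "0 < \<zeta>" "\<theta> \<in> Params \<delta> \<zeta>" "\<theta>' \<in> Params \<delta> \<zeta>" "X \<in> adjacencies n T" "chi \<in> Vparams n T"
  shows "elbo n T X chi \<theta> - elbo n T X chi \<theta>'
    \<le> (\<Sum>Z\<in>labellings n T. \<bar>ln (pmf (dsbm n T \<theta>) (Z, X)) - ln (pmf (dsbm n T \<theta>') (Z, X))\<bar>)"
  unfolding elbo_eq_sum[OF assms(1-3,5,6)] elbo_eq_sum[OF assms(1,2,4,5,6)] sum_subtractf[symmetric]
proof (rule sum_mono)
  fix Z :: "'q labelling"
  define a b where "a = pmf (variational_law n T chi) Z"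
    and "b = ln (pmf (dsbm n T \<theta>) (Z, X)) - ln (pmf (dsbm n T \<theta>') (Z, X))"
  have "a * b \<le> \<bar>a * b\<bar>" by simp
  also have "\<dots> \<le> \<bar>b\<bar>" by (simp add: abs_mult a_def pmf_le_1 mult_left_le_one_le)
  finally show "pmf (variational_law n T chi) Z * (ln (pmf (dsbm n T \<theta>) (Z, X)) - ln (pmf (variational_law n T chi) Z))
     - pmf (variational_law n T chi) Z * (ln (pmf (dsbm n T \<theta>') (Z, X)) - ln (pmf (variational_law n T chi) Z))
     \<le> \<bar>ln (pmf (dsbm n T \<theta>) (Z, X)) - ln (pmf (dsbm n T \<theta>') (Z, X))\<bar>"
    by (simp add: a_def b_def algebra_simps)
qed

text \<open>
  A maximum over \<open>chi\<close> of functions whose increments in \<open>\<theta>\<close> are bounded uniformly in \<open>chi\<close>.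
\<close>

lemma continuous_on_optimal_elbo:
  fixes chi :: "('q::finite) param \<Rightarrow> 'q vparam"
  assumes \<delta>: "0 < \<delta>" and \<zeta>: "0 < \<zeta>" and X: "X \<in> adjacencies n T"
    and max: "\<And>\<theta>. \<theta> \<in> Params \<delta> \<zeta> \<Longrightarrow>
      is_arg_max (\<lambda>chi. elbo n T X chi \<theta>) (\<lambda>chi. chi \<in> Vparams n T) (chi \<theta>)"
  shows "continuous_on (Params \<delta> \<zeta>) (\<lambda>\<theta>. elbo n T X (chi \<theta>) \<theta>)"
  unfolding continuous_on_def
proof
  fix \<theta>' :: "'q param" assume \<theta>': "\<theta>' \<in> Params \<delta> \<zeta>"
  define g where "g \<theta> = (\<Sum>Z\<in>labellings n T. \<bar>ln (pmf (dsbm n T \<theta>) (Z, X)) - ln (pmf (dsbm n T \<theta>') (Z, X))\<bar>)"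
    for \<theta> :: "'q param"
  have "continuous_on (Params \<delta> \<zeta>) g"
    unfolding g_def
  proof (intro continuous_intros continuous_on_pmf_dsbm[OF \<delta> \<zeta>] X ballI)
    fix Z :: "'q labelling" and \<theta> :: "'q param" assume "Z \<in> labellings n T" "\<theta> \<in> Params \<delta> \<zeta>"
    then show "pmf (dsbm n T \<theta>) (Z, X) \<noteq> 0" using pmf_dsbm_pos[OF \<delta> \<zeta> _ _ X, of \<theta> Z] by simp
  qed
  then have "(g \<longlongrightarrow> g \<theta>') (at \<theta>' within Params \<delta> \<zeta>)"
    using \<theta>' by (auto simp: continuous_on_def)
  then have g: "(g \<longlongrightarrow> 0) (at \<theta>' within Params \<delta> \<zeta>)" by (simp add: g_def)
  have V: "chi \<theta> \<in> Vparams n T" if "\<theta> \<in> Params \<delta> \<zeta>" for \<theta>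
    using max[OF that] by (simp add: is_arg_max_linorder)
  have opt: "elbo n T X c \<theta> \<le> elbo n T X (chi \<theta>) \<theta>" if "\<theta> \<in> Params \<delta> \<zeta>" "c \<in> Vparams n T" for c \<theta>
    using max[OF that(1)] that(2) unfolding is_arg_max_linorder by blast
  have "norm (elbo n T X (chi \<theta>) \<theta> - elbo n T X (chi \<theta>') \<theta>') \<le> g \<theta>" if \<theta>: "\<theta> \<in> Params \<delta> \<zeta>" for \<theta>
  proof -
    have "elbo n T X (chi \<theta>) \<theta> - elbo n T X (chi \<theta>) \<theta>' \<le> g \<theta>"
      unfolding g_def by (rule elbo_diff_le[OF \<delta> \<zeta> \<theta> \<theta>' X V[OF \<theta>]])
    moreover have "elbo n T X (chi \<theta>') \<theta>' - elbo n T X (chi \<theta>') \<theta> \<le> g \<theta>"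
      using elbo_diff_le[OF \<delta> \<zeta> \<theta>' \<theta> X V[OF \<theta>']] by (simp add: g_def abs_minus_commute)
    ultimately show ?thesis
      using opt[OF \<theta> V[OF \<theta>']] opt[OF \<theta>' V[OF \<theta>]] by simp
  qed
  then have "((\<lambda>\<theta>. elbo n T X (chi \<theta>) \<theta> - elbo n T X (chi \<theta>') \<theta>') \<longlongrightarrow> 0) (at \<theta>' within Params \<delta> \<zeta>)"
    by (intro Lim_null_comparison[OF _ g]) (auto simp: eventually_at_filter)
  then show "((\<lambda>\<theta>. elbo n T X (chi \<theta>) \<theta>) \<longlongrightarrow> elbo n T X (chi \<theta>') \<theta>') (at \<theta>' within Params \<delta> \<zeta>)"
    by (simp add: LIM_zero_iff)
qed

section \<open>From the likelihood gap to matching blocks\<close>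

definition pairs :: "nat \<Rightarrow> (nat \<times> nat) set" where
  "pairs n = {(i, j). i \<in> {1..n} \<and> j \<in> {1..n} \<and> i < j}"

lemma finite_pairs: "finite (pairs n)"
  by (rule finite_subset[of _ "{1..n} \<times> {1..n}"]) (auto simp: pairs_def)

lemma dyads_eq_times_pairs: "dyads n T = {1..T} \<times> pairs n"
  by (auto simp: dyads_def pairs_def)

text \<open>
  The Kullback-Leibler divergence of two Bernoulli laws dominates the squared Hellinger distance,
  which follows from \<open>ln y \<le> y - 1\<close> at a square root, and \<open>\<bar>p - x\<bar> \<le> 2 \<bar>sqrt p - sqrt x\<bar>\<close>.
\<close>

lemma bernoulli_divergence_ge:
  fixes p x :: real
  assumes p: "0 < p" "p < 1" and x: "0 < x" "x < 1"
  shows "(p - x)\<^sup>2 / 4 \<le> p * (ln p - ln x) + (1 - p) * (ln (1 - p) - ln (1 - x))"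
proof -
  have hellinger: "2 * a - 2 * (sqrt a * sqrt b) \<le> a * (ln a - ln b)" if "0 < a" "0 < b" for a b :: real
  proof -
    have "ln (sqrt (b / a)) \<le> sqrt (b / a) - 1" using that by (intro ln_le_minus_one) auto
    moreover have "ln (sqrt (b / a)) = (ln b - ln a) / 2" using that by (simp add: ln_sqrt ln_div)
    ultimately have "ln b - ln a \<le> 2 * (sqrt (b / a) - 1)" by simp
    then have "a * (ln b - ln a) \<le> a * (2 * (sqrt (b / a) - 1))"
      using that by (intro mult_left_mono) auto
    moreover have "a * sqrt (b / a) = sqrt a * sqrt b"
      using that by (simp add: real_sqrt_divide real_div_sqrt field_simps)
    ultimately show ?thesis by (simp add: algebra_simps)
  qed
  have "\<bar>p - x\<bar> = \<bar>sqrt p - sqrt x\<bar> * (sqrt p + sqrt x)"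
  proof -
    have "p - x = (sqrt p - sqrt x) * (sqrt p + sqrt x)" using p x by (simp add: algebra_simps)
    then show ?thesis using p x by (simp add: abs_mult)
  qed
  also have "\<dots> \<le> \<bar>sqrt p - sqrt x\<bar> * 2"
  proof (rule mult_left_mono)
    have "sqrt p \<le> 1" "sqrt x \<le> 1" using p x by auto
    then show "sqrt p + sqrt x \<le> 2" by linarith
  qed simp
  finally have "\<bar>p - x\<bar>\<^sup>2 \<le> (\<bar>sqrt p - sqrt x\<bar> * 2)\<^sup>2" by (intro power_mono) auto
  then have "(p - x)\<^sup>2 / 4 \<le> (sqrt p - sqrt x)\<^sup>2" by (simp add: power_mult_distrib)
  also have "\<dots> \<le> (sqrt p - sqrt x)\<^sup>2 + (sqrt (1 - p) - sqrt (1 - x))\<^sup>2" by simp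
  also have "\<dots> = 2 * p - 2 * (sqrt p * sqrt x) + (2 * (1 - p) - 2 * (sqrt (1 - p) * sqrt (1 - x)))"
    using p x by (simp add: power2_diff)
  also have "\<dots> \<le> p * (ln p - ln x) + (1 - p) * (ln (1 - p) - ln (1 - x))"
    using p x by (intro add_mono hellinger) auto
  finally show ?thesis .
qed

definition balanced :: "real \<Rightarrow> nat \<Rightarrow> nat \<Rightarrow> 'q labelling \<Rightarrow> bool" where
  "balanced c n T Z \<longleftrightarrow> (\<forall>t\<in>{1..T}. \<forall>q. c \<le> real (card {i \<in> {1..n}. Z i t = q}))"

text \<open>
  A bound on the cut norm of the upper triangle of \<open>X - E(X | Z)\<close> at every time.
\<close>

definition concentrated ::
    "real \<Rightarrow> nat \<Rightarrow> nat \<Rightarrow> real ^ ('q::finite) ^ 'q \<Rightarrow> 'q labelling \<Rightarrow> adjacency \<Rightarrow> bool" where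
  "concentrated s n T \<pi> Z X \<longleftrightarrow> (\<forall>t\<in>{1..T}. \<forall>A\<subseteq>{1..n}. \<forall>B\<subseteq>{1..n}.
     \<bar>\<Sum>(i, j)\<in>pairs n \<inter> A \<times> B. of_bool (X t i j) - \<pi> $ Z i t $ Z j t\<bar> \<le> s)"

text \<open>
  A weight that depends only on the classes of the two end points is a combination of \<open>Q\<^sup>2\<close>
  rectangle indicators. So control of the noise \<open>e\<close> on all rectangles controls it against every
  labelling \<open>c\<close> and every matrix \<open>w\<close> at once.
\<close>

lemma abs_sum_block_constant_le:
  fixes w :: "'q::finite \<Rightarrow> 'q \<Rightarrow> real"
  assumes w: "\<And>a b. \<bar>w a b\<bar> \<le> W"
    and s: "\<And>A B. A \<subseteq> {1..n} \<Longrightarrow> B \<subseteq> {1..n} \<Longrightarrow> \<bar>\<Sum>(i, j)\<in>pairs n \<inter> A \<times> B. e i j\<bar> \<le> s"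
  shows "\<bar>\<Sum>(i, j)\<in>pairs n. e i j * w (c i) (c j)\<bar> \<le> (real CARD('q))\<^sup>2 * (W * s)"
proof -
  define block where "block a = {i \<in> {1..n}. c i = a}" for a
  have "(\<Sum>(i, j)\<in>pairs n. e i j * w (c i) (c j))
      = (\<Sum>(a, b)\<in>UNIV. \<Sum>(i, j)\<in>{d \<in> pairs n. map_prod c c d = (a, b)}. e i j * w (c i) (c j))"
    by (subst sum.group[of "pairs n" UNIV "map_prod c c", symmetric]) (auto simp: finite_pairs)
  also have "\<dots> = (\<Sum>(a, b)\<in>UNIV. w a b * (\<Sum>(i, j)\<in>pairs n \<inter> block a \<times> block b. e i j))"
    unfolding sum_distrib_left
    by (intro sum.cong refl) (auto simp: block_def pairs_def intro!: sum.cong)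
  also have "\<bar>\<dots>\<bar> \<le> (\<Sum>(a, b)\<in>(UNIV :: ('q \<times> 'q) set). W * s)"
  proof (intro order_trans[OF sum_abs] sum_mono)
    fix d :: "'q \<times> 'q"
    obtain a b where d: "d = (a, b)" by fastforce
    have "\<bar>w a b\<bar> * \<bar>\<Sum>(i, j)\<in>pairs n \<inter> block a \<times> block b. e i j\<bar> \<le> W * s"
      using w[of a b] by (intro mult_mono s) (auto simp: block_def)
    then show "\<bar>case d of (a, b) \<Rightarrow> w a b * (\<Sum>(i, j)\<in>pairs n \<inter> block a \<times> block b. e i j)\<bar>
        \<le> (case d of (a, b) \<Rightarrow> W * s)"
      by (simp add: d abs_mult)
  qed
  also have "\<dots> = (real CARD('q))\<^sup>2 * (W * s)"
    by (simp add: case_prod_unfold card_cartesian_product power2_eq_square flip: UNIV_Times_UNIV)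
  finally show ?thesis .
qed

lemma abs_logit_le:
  fixes x \<zeta> :: real
  assumes "0 < \<zeta>" "\<zeta> \<le> x" "x \<le> 1 - \<zeta>"
  shows "\<bar>ln x - ln (1 - x)\<bar> \<le> ln ((1 - \<zeta>) / \<zeta>)"
proof -
  have "ln \<zeta> \<le> ln x" "ln x \<le> ln (1 - \<zeta>)" "ln \<zeta> \<le> ln (1 - x)" "ln (1 - x) \<le> ln (1 - \<zeta>)"
    using assms by auto
  moreover have "ln ((1 - \<zeta>) / \<zeta>) = ln (1 - \<zeta>) - ln \<zeta>" using assms by (simp add: ln_div)
  ultimately show ?thesis by linarith
qed

lemma ln_observation_law:
  assumes "0 < \<zeta>" "\<theta> \<in> Params \<delta> \<zeta>" "X \<in> adjacencies n T" "0 < \<delta>"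
  shows "ln (pmf (observation_law n T (snd \<theta>) Z) X)
    = (\<Sum>t=1..T. \<Sum>(i, j)\<in>pairs n. of_bool (X t i j) * ln (snd \<theta> $ Z i t $ Z j t)
         + (1 - of_bool (X t i j)) * ln (1 - snd \<theta> $ Z i t $ Z j t))"
proof -
  have pos: "snd \<theta> $ q $ l \<noteq> 0" "snd \<theta> $ q $ l \<noteq> 1" for q l
    using ParamsD(3,4)[OF assms(2), of q l] assms(1) by auto
  have "ln (pmf (observation_law n T (snd \<theta>) Z) X)
      = (\<Sum>d\<in>dyads n T. ln (case d of (t, i, j) \<Rightarrow>
          if X t i j then snd \<theta> $ Z i t $ Z j t else 1 - snd \<theta> $ Z i t $ Z j t))"
    unfolding pmf_observation_law_Params[OF assms(4,1-3)]
    by (rule ln_prod[OF finite_dyads]) (use pos in \<open>auto split: prod.splits\<close>)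
  also have "\<dots> = (\<Sum>(t, i, j)\<in>dyads n T. of_bool (X t i j) * ln (snd \<theta> $ Z i t $ Z j t)
         + (1 - of_bool (X t i j)) * ln (1 - snd \<theta> $ Z i t $ Z j t))"
    by (intro sum.cong refl) auto
  finally show ?thesis
    unfolding dyads_eq_times_pairs by (simp add: sum.cartesian_product case_prod_unfold)
qed

text \<open>
  The expected log-likelihood ratio of a dyad is minus a Bernoulli divergence. What remains is
  noise, namely \<open>X - \<pi>'\<close> weighted by logits of connection probabilities; it is
  block constant for \<open>z\<close> in one term and for \<open>Z\<close> in the other.
\<close>

lemma log_likelihood_gap_le:
  fixes \<theta> \<theta>' :: "('q::finite) param"
  assumes "0 < \<delta>" "0 < \<zeta>" and \<theta>: "\<theta> \<in> Params \<delta> \<zeta>" and \<theta>': "\<theta>' \<in> Params \<delta> \<zeta>"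
    and X: "X \<in> adjacencies n T"
    and conc: "concentrated s n T (snd \<theta>') Z X"
  defines "\<Lambda> \<equiv> ln ((1 - \<zeta>) / \<zeta>)"
  shows "ln (pmf (observation_law n T (snd \<theta>) z) X) - ln (pmf (observation_law n T (snd \<theta>') Z) X)
    \<le> (\<Sum>t=1..T. 2 * (real CARD('q))\<^sup>2 * \<Lambda> * s
         - (\<Sum>(i, j)\<in>pairs n. (snd \<theta>' $ Z i t $ Z j t - snd \<theta> $ z i t $ z j t)\<^sup>2 / 4))"
  unfolding ln_observation_law[OF assms(2) \<theta> X assms(1)] ln_observation_law[OF assms(2) \<theta>' X assms(1)]
proof (subst sum_subtractf[symmetric], rule sum_mono)
  fix t assume t: "t \<in> {1..T}"
  define x where "x i j = snd \<theta> $ z i t $ z j t" for i j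
  define p where "p i j = snd \<theta>' $ Z i t $ Z j t" for i j
  define b :: "nat \<Rightarrow> nat \<Rightarrow> real" where "b i j = of_bool (X t i j)" for i j
  define D where "D i j = p i j * (ln (p i j) - ln (x i j)) + (1 - p i j) * (ln (1 - p i j) - ln (1 - x i j))" for i j
  \<comment> \<open>The linear part of the log-likelihood at the matrix \<open>y\<close> of dyad probabilities.\<close>
  define noise where "noise y = (\<Sum>(i, j)\<in>pairs n. (b i j - p i j) * (ln (y i j) - ln (1 - y i j)))" for y
  have noise: "\<bar>noise (\<lambda>i j. snd \<eta> $ c i t $ c j t)\<bar> \<le> (real CARD('q))\<^sup>2 * (\<Lambda> * s)"
    if "\<eta> \<in> Params \<delta> \<zeta>" for \<eta> :: "'q param" and c
    unfolding noise_def
  proof (rule abs_sum_block_constant_le[where w = "\<lambda>a b. ln (snd \<eta> $ a $ b) - ln (1 - snd \<eta> $ a $ b)"])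
    show "\<bar>ln (snd \<eta> $ q $ l) - ln (1 - snd \<eta> $ q $ l)\<bar> \<le> \<Lambda>" for q l
      unfolding \<Lambda>_def by (rule abs_logit_le[OF assms(2) ParamsD(3,4)[OF that]])
    show "\<bar>\<Sum>(i, j)\<in>pairs n \<inter> A \<times> B. b i j - p i j\<bar> \<le> s" if "A \<subseteq> {1..n}" "B \<subseteq> {1..n}" for A B
      using conc t that unfolding concentrated_def b_def p_def by blast
  qed
  have kl: "(p i j - x i j)\<^sup>2 / 4 \<le> D i j" for i j
    using ParamsD(3,4)[OF \<theta>, of "z i t" "z j t"] ParamsD(3,4)[OF \<theta>', of "Z i t" "Z j t"] assms(2)
    unfolding D_def p_def x_def by (intro bernoulli_divergence_ge) auto
  have "(\<Sum>(i, j)\<in>pairs n. b i j * ln (x i j) + (1 - b i j) * ln (1 - x i j))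
      - (\<Sum>(i, j)\<in>pairs n. b i j * ln (p i j) + (1 - b i j) * ln (1 - p i j))
      = noise x - noise p - (\<Sum>(i, j)\<in>pairs n. D i j)"
    unfolding noise_def sum_subtractf[symmetric] D_def
    by (intro sum.cong refl) (auto simp: algebra_simps)
  also have "\<dots> \<le> 2 * (real CARD('q))\<^sup>2 * \<Lambda> * s - (\<Sum>(i, j)\<in>pairs n. (p i j - x i j)\<^sup>2 / 4)"
  proof -
    have "(\<Sum>(i, j)\<in>pairs n. (p i j - x i j)\<^sup>2 / 4) \<le> (\<Sum>(i, j)\<in>pairs n. D i j)"
      using kl by (intro sum_mono) auto
    moreover have "\<bar>noise x\<bar> \<le> (real CARD('q))\<^sup>2 * (\<Lambda> * s)" "\<bar>noise p\<bar> \<le> (real CARD('q))\<^sup>2 * (\<Lambda> * s)"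
      unfolding x_def p_def by (intro noise \<theta> \<theta>')+
    ultimately show ?thesis by (simp add: mult.assoc)
  qed
  finally show "(\<Sum>(i, j)\<in>pairs n. of_bool (X t i j) * ln (snd \<theta> $ z i t $ z j t)
         + (1 - of_bool (X t i j)) * ln (1 - snd \<theta> $ z i t $ z j t))
       - (\<Sum>(i, j)\<in>pairs n. of_bool (X t i j) * ln (snd \<theta>' $ Z i t $ Z j t)
         + (1 - of_bool (X t i j)) * ln (1 - snd \<theta>' $ Z i t $ Z j t))
    \<le> 2 * (real CARD('q))\<^sup>2 * \<Lambda> * s
         - (\<Sum>(i, j)\<in>pairs n. (snd \<theta>' $ Z i t $ Z j t - snd \<theta> $ z i t $ z j t)\<^sup>2 / 4)"
    by (simp add: x_def p_def b_def)
qed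

lemma large_subclass_exists:
  fixes z :: "nat \<Rightarrow> 'q::finite"
  assumes "finite I" "c \<le> real (card I)"
  shows "\<exists>a. c / real CARD('q) \<le> real (card {i \<in> I. z i = a})"
proof (rule ccontr)
  assume "\<not> ?thesis"
  then have "(\<Sum>a\<in>UNIV. real (card {i \<in> I. z i = a})) < (\<Sum>a\<in>(UNIV :: 'q set). c / real CARD('q))"
    by (intro sum_strict_mono) (auto simp: not_le)
  moreover have "(\<Sum>a\<in>UNIV. card {i \<in> I. z i = a}) = card I"
    using sum.group[of I UNIV z "\<lambda>_. 1 :: nat"] assms(1) by simp
  then have "(\<Sum>a\<in>UNIV. real (card {i \<in> I. z i = a})) = real (card I)"
    by (metis of_nat_sum)
  ultimately show False using assms(2) by simp
qed

lemma sum_offdiagonal_eq_twice_pairs: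
  fixes F :: "nat \<Rightarrow> nat \<Rightarrow> real"
  assumes "\<And>i j. F i j = F j i"
  shows "(\<Sum>(i, j)\<in>{1..n} \<times> {1..n} - Id. F i j) = 2 * (\<Sum>(i, j)\<in>pairs n. F i j)"
proof -
  have "{1..n} \<times> {1..n} - Id = pairs n \<union> prod.swap ` pairs n"
    by (auto simp: pairs_def image_iff)
  moreover have "pairs n \<inter> prod.swap ` pairs n = {}" by (auto simp: pairs_def)
  ultimately have "(\<Sum>(i, j)\<in>{1..n} \<times> {1..n} - Id. F i j)
      = (\<Sum>(i, j)\<in>pairs n. F i j) + (\<Sum>(i, j)\<in>prod.swap ` pairs n. F i j)"
    by (simp add: sum.union_disjoint finite_pairs)
  also have "(\<Sum>(i, j)\<in>prod.swap ` pairs n. F i j) = (\<Sum>(i, j)\<in>pairs n. F j i)"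
    by (subst sum.reindex) (auto simp: case_prod_unfold)
  also have "\<dots> = (\<Sum>(i, j)\<in>pairs n. F i j)" by (simp add: assms[of _ _])
  finally show ?thesis by simp
qed

text \<open>
  Send a true class \<open>q\<close> to the label \<open>f q\<close> that is most frequent in it under \<open>z\<close>. The nodes of
  class \<open>q\<close> with label \<open>f q\<close> and those of class \<open>l\<close> with label \<open>f l\<close> span of order \<open>c\<^sup>2 / Q\<^sup>2\<close> pairs,
  all contributing the same square \<open>(A\<^sub>q\<^sub>l - B\<^sub>f\<^sub>q\<^sub>,\<^sub>f\<^sub>l)\<^sup>2\<close> to the sum; the summand \<open>n\<close> accounts for the
  diagonal, which is absent from it.
\<close>

lemma block_matching:
  fixes A B :: "real ^ ('q::finite) ^ 'q" and Z z :: "nat \<Rightarrow> 'q"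
  assumes A: "\<And>q l. A $ q $ l \<in> {0..1}" "\<And>q l. A $ q $ l = A $ l $ q"
    and B: "\<And>q l. B $ q $ l \<in> {0..1}" "\<And>q l. B $ q $ l = B $ l $ q"
    and c: "0 \<le> c" "\<And>q. c \<le> real (card {i \<in> {1..n}. Z i = q})"
    and R: "(\<Sum>(i, j)\<in>pairs n. (A $ Z i $ Z j - B $ z i $ z j)\<^sup>2) \<le> R"
  obtains f where "\<And>q l. (c / real CARD('q))\<^sup>2 * (A $ q $ l - B $ f q $ f l)\<^sup>2 \<le> 2 * R + real n"
proof -
  have "\<exists>a. c / real CARD('q) \<le> real (card {i \<in> {i \<in> {1..n}. Z i = q}. z i = a})" for q
    using large_subclass_exists[of "{i \<in> {1..n}. Z i = q}" c z] c(2) by simp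
  then obtain f where f: "\<And>q. c / real CARD('q) \<le> real (card {i \<in> {i \<in> {1..n}. Z i = q}. z i = f q})"
    by (atomize_elim, intro choice allI)
  define C where "C q = {i \<in> {1..n}. Z i = q \<and> z i = f q}" for q
  have C: "c / real CARD('q) \<le> real (card (C q))" for q
    using f[of q] by (simp add: C_def conj_assoc)
  have "(c / real CARD('q))\<^sup>2 * (A $ q $ l - B $ f q $ f l)\<^sup>2 \<le> 2 * R + real n" for q l
  proof -
    define d2 where "d2 = (A $ q $ l - B $ f q $ f l)\<^sup>2"
    have "\<bar>A $ q $ l - B $ f q $ f l\<bar> \<le> 1" using A(1)[of q l] B(1)[of "f q" "f l"] by auto
    then have d2: "0 \<le> d2" "d2 \<le> 1" unfolding d2_def by (auto simp: abs_square_le_1)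
    \<comment> \<open>Only the pairs with \<open>i = j\<close>, at most \<open>n\<close> of them, have to be discarded.\<close>
    have "C q \<times> C l - Id = C q \<times> C l - (\<lambda>i. (i, i)) ` {1..n}"
      by (auto simp: C_def)
    then have "card (C q) * card (C l) - n \<le> card (C q \<times> C l - Id)"
      using diff_card_le_card_Diff[of "(\<lambda>i. (i, i)) ` {1..n}" "C q \<times> C l"]
      by (simp add: card_cartesian_product card_image inj_on_def)
    then have "card (C q) * card (C l) \<le> card (C q \<times> C l - Id) + n" by simp
    then have "real (card (C q)) * real (card (C l)) - real n \<le> real (card (C q \<times> C l - Id))"
      by (simp add: of_nat_mono flip: of_nat_mult of_nat_add add: diff_le_eq)
    then have "(real (card (C q)) * real (card (C l)) - real n) * d2 \<le> real (card (C q \<times> C l - Id)) * d2"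
      using d2 by (intro mult_right_mono) auto
    also have "\<dots> = (\<Sum>(i, j)\<in>C q \<times> C l - Id. (A $ Z i $ Z j - B $ z i $ z j)\<^sup>2)"
      by (subst sum.cong[OF refl, of _ _ "\<lambda>_. d2"]) (auto simp: C_def d2_def)
    also have "\<dots> \<le> (\<Sum>(i, j)\<in>{1..n} \<times> {1..n} - Id. (A $ Z i $ Z j - B $ z i $ z j)\<^sup>2)"
      by (intro sum_mono2) (auto simp: C_def)
    also have "\<dots> = 2 * (\<Sum>(i, j)\<in>pairs n. (A $ Z i $ Z j - B $ z i $ z j)\<^sup>2)"
      by (rule sum_offdiagonal_eq_twice_pairs) (metis A(2) B(2))
    also have "\<dots> \<le> 2 * R" using R by simp
    finally have "real (card (C q)) * real (card (C l)) * d2 \<le> 2 * R + real n * d2"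
      by (simp add: algebra_simps)
    moreover have "(c / real CARD('q))\<^sup>2 * d2 \<le> real (card (C q)) * real (card (C l)) * d2"
      unfolding power2_eq_square using C c(1) d2 by (intro mult_right_mono mult_mono) auto
    moreover have "real n * d2 \<le> real n" using d2 by (intro mult_left_le) auto
    ultimately show ?thesis by (simp add: d2_def)
  qed
  then show ?thesis using that by blast
qed

section \<open>Maximisers lie near the truth\<close>

definition label_switch_ball :: "real \<Rightarrow> real ^ ('q::finite) ^ 'q \<Rightarrow> (real ^ 'q ^ 'q) set" where
  "label_switch_ball \<rho> \<pi>' = {\<pi>. \<exists>\<sigma>. \<sigma> permutes UNIV \<and> (\<forall>q l. \<bar>\<pi> $ \<sigma> q $ \<sigma> l - \<pi>' $ q $ l\<bar> \<le> \<rho>)}"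

definition separated :: "real \<Rightarrow> real ^ ('q::finite) ^ 'q \<Rightarrow> bool" where
  "separated g \<pi> \<longleftrightarrow> (\<forall>q q'. q \<noteq> q' \<longrightarrow> (\<exists>l. g \<le> \<bar>\<pi> $ q $ l - \<pi> $ q' $ l\<bar>))"

lemma Params_separated:
  assumes "\<theta> \<in> Params \<delta> \<zeta>"
  obtains g where "0 < g" "separated g (snd \<theta> :: real ^ ('q::finite) ^ 'q)"
proof -
  \<comment> \<open>The value 1 keeps the minimum defined when there is a single class.\<close>
  define D where
    "D = (\<lambda>(q, q', l). \<bar>snd \<theta> $ q $ l - snd \<theta> $ q' $ l\<bar>) ` {(q, q', l). snd \<theta> $ q $ l \<noteq> snd \<theta> $ q' $ l}"
  have fin: "finite (insert 1 D)" by (simp add: D_def)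
  define g where "g = Min (insert 1 D)"
  have "g \<in> insert 1 D" unfolding g_def by (rule Min_in[OF fin]) simp
  then have "0 < g" by (auto simp: D_def)
  moreover have "separated g (snd \<theta>)"
    unfolding separated_def
  proof (intro allI impI)
    fix q q' :: 'q assume "q \<noteq> q'"
    then obtain l where l: "snd \<theta> $ q $ l \<noteq> snd \<theta> $ q' $ l" using assms by (auto simp: Params_def) blast
    then have "\<bar>snd \<theta> $ q $ l - snd \<theta> $ q' $ l\<bar> \<in> insert 1 D"
      unfolding D_def by (intro insertI2 rev_image_eqI[of "(q, q', l)"]) auto
    then show "\<exists>l. g \<le> \<bar>snd \<theta> $ q $ l - snd \<theta> $ q' $ l\<bar>"
      unfolding g_def using Min_le[OF fin] by blast
  qed
  ultimately show ?thesis using that by blast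
qed

definition rate_const :: "real \<Rightarrow> real \<Rightarrow> nat \<Rightarrow> real" where
  "rate_const \<delta> \<zeta> Q = (16 * (real Q)\<^sup>2 * ln ((1 - \<zeta>) / \<zeta>) + 8 * ln (1 / \<delta>) + 1) * (4 * (real Q)\<^sup>2 / \<delta>\<^sup>2)"

text \<open>
  The deterministic error on the event that the labels are balanced and the graphs concentrated; its
  square is an upper bound for \<open>2 R + n\<close> divided by the squared size \<open>(\<delta> n / (2 Q))\<^sup>2\<close> of the matched subclasses, where \<open>R\<close> bounds
  the squared error summed over the pairs at one time.
\<close>

definition radius :: "real \<Rightarrow> real \<Rightarrow> nat \<Rightarrow> nat \<Rightarrow> real" where
  "radius \<delta> \<zeta> Q n = sqrt (rate_const \<delta> \<zeta> Q) * real n powr - (1 / 4)"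

text \<open>
  An objective value at least that of the truth yields a labelling \<open>z\<close> under which \<open>\<theta>\<close> explains the
  graphs almost as well as the truth does with \<open>Z\<close>. By averaging, this holds at some single time,
  where the blocks of the two matrices can be matched. The matching map is injective since two rows
  of \<open>\<pi>'\<close> near the same row of \<open>\<pi>\<close> would be nearer to each other than \<open>g\<close>.
\<close>

lemma near_optimal_close:
  fixes \<theta> \<theta>' :: "('q::finite) param"
  assumes \<delta>: "0 < \<delta>" "\<delta> < 1" and \<zeta>: "0 < \<zeta>" "\<zeta> < 1 / 2"
    and n: "n \<ge> 1" and T: "T \<ge> 1"
    and \<theta>: "\<theta> \<in> Params \<delta> \<zeta>" and \<theta>': "\<theta>' \<in> Params \<delta> \<zeta>"
    and X: "X \<in> adjacencies n T" and Z: "Z \<in> labellings n T"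
    and bal: "balanced (\<delta> / 2 * real n) n T Z"
    and conc: "concentrated (real n powr (3 / 2)) n T (snd \<theta>') Z X"
    and sep: "separated g (snd \<theta>')" "2 * radius \<delta> \<zeta> CARD('q) n < g"
    and chi: "is_arg_max (\<lambda>chi. elbo n T X chi \<theta>) (\<lambda>chi. chi \<in> Vparams n T) chi"
    and chi': "is_arg_max (\<lambda>chi. elbo n T X chi \<theta>') (\<lambda>chi. chi \<in> Vparams n T) chi'"
    and ge: "elbo n T X chi' \<theta>' \<le> elbo n T X chi \<theta>"
  shows "snd \<theta> \<in> label_switch_ball (radius \<delta> \<zeta> CARD('q) n) (snd \<theta>')"
proof -
  define Q where "Q = real CARD('q)"
  define s where "s = real n powr (3 / 2)"
  define \<Lambda> where "\<Lambda> = ln ((1 - \<zeta>) / \<zeta>)"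
  define R where "R = 8 * Q\<^sup>2 * \<Lambda> * s + 4 * real n * ln (1 / \<delta>)"
  have Q: "1 \<le> Q" unfolding Q_def by simp
  have \<Lambda>: "0 \<le> \<Lambda>" unfolding \<Lambda>_def using \<zeta> by simp
  have ln\<delta>: "0 \<le> ln (1 / \<delta>)" using \<delta> by simp
  obtain z where z: "z \<in> labellings n T" "log_likelihood n T X \<theta> \<le> ln (pmf (observation_law n T (snd \<theta>) z) X)"
    using log_likelihood_le_complete[OF \<delta>(1) \<zeta>(1) \<theta> X] .
  define S where "S t = (\<Sum>(i, j)\<in>pairs n. (snd \<theta>' $ Z i t $ Z j t - snd \<theta> $ z i t $ z j t)\<^sup>2)" for t
  have "ln (pmf (observation_law n T (snd \<theta>') Z) X) - real n * real T * ln (1 / \<delta>) \<le> elbo n T X chi' \<theta>'"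
    by (rule elbo_optimal_ge_complete[OF \<delta>(1) \<zeta>(1) \<theta>' X Z chi'])
  also have "\<dots> \<le> log_likelihood n T X \<theta>"
    using ge elbo_le_log_likelihood[OF \<delta>(1) \<zeta>(1) \<theta> X, of chi] chi by (simp add: is_arg_max_def)
  finally have "- (real n * real T * ln (1 / \<delta>))
      \<le> ln (pmf (observation_law n T (snd \<theta>) z) X) - ln (pmf (observation_law n T (snd \<theta>') Z) X)"
    using z(2) by linarith
  also have "\<dots> \<le> (\<Sum>t=1..T. 2 * Q\<^sup>2 * \<Lambda> * s - S t / 4)"
    using log_likelihood_gap_le[OF \<delta>(1) \<zeta>(1) \<theta> \<theta>' X conc, of z]
    by (simp add: Q_def s_def \<Lambda>_def S_def sum_divide_distrib case_prod_unfold)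
  also have "\<dots> = real T * (2 * Q\<^sup>2 * \<Lambda> * s) - (\<Sum>t=1..T. S t) / 4"
    by (simp add: sum_subtractf sum_divide_distrib)
  finally have sum_S: "(\<Sum>t=1..T. S t) \<le> (\<Sum>t=1..T. R)"
    by (simp add: R_def algebra_simps)
  \<comment> \<open>A time at which the squared error is at most the bound on its average.\<close>
  have "\<exists>t\<in>{1..T}. S t \<le> R"
  proof (rule ccontr)
    assume "\<not> ?thesis"
    then have "(\<Sum>t=1..T. R) < (\<Sum>t=1..T. S t)"
      using T by (intro sum_strict_mono) (auto simp: not_le)
    with sum_S show False by simp
  qed
  then obtain t where t: "t \<in> {1..T}" "S t \<le> R" by blast
  have unit: "snd \<eta> $ q $ l \<in> {0..1}" if "\<eta> \<in> Params \<delta> \<zeta>" for \<eta> :: "'q param" and q l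
    using ParamsD(3,4)[OF that, of q l] \<zeta> by auto
  obtain f where f: "\<And>q l. (\<delta> / 2 * real n / Q)\<^sup>2 * (snd \<theta>' $ q $ l - snd \<theta> $ f q $ f l)\<^sup>2 \<le> 2 * R + real n"
  proof (rule block_matching[of "snd \<theta>'" "snd \<theta>" "\<delta> / 2 * real n" n "\<lambda>i. Z i t" "\<lambda>i. z i t" R])
    show "\<delta> / 2 * real n \<le> real (card {i \<in> {1..n}. Z i t = q})" for q
      using bal t(1) by (auto simp: balanced_def)
    show "snd \<theta>' $ q $ l = snd \<theta>' $ l $ q" "snd \<theta> $ q $ l = snd \<theta> $ l $ q" for q l
      using Params_symmetric[OF \<theta>'] Params_symmetric[OF \<theta>] by blast+
    show "(\<Sum>(i, j)\<in>pairs n. (snd \<theta>' $ Z i t $ Z j t - snd \<theta> $ z i t $ z j t)\<^sup>2) \<le> R"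
      using t(2) by (simp only: S_def)
  qed (use unit[OF \<theta>] unit[OF \<theta>'] \<delta>(1) in \<open>auto simp: Q_def\<close>)
  have close: "\<bar>snd \<theta> $ f q $ f l - snd \<theta>' $ q $ l\<bar> \<le> radius \<delta> \<zeta> CARD('q) n" for q l
  proof -
    define d where "d = snd \<theta> $ f q $ f l - snd \<theta>' $ q $ l"
    define C where "C = 16 * Q\<^sup>2 * \<Lambda> + 8 * ln (1 / \<delta>) + 1"
    have n_le: "real n \<le> s"
      using n powr_mono[of 1 "3 / 2" "real n"] by (simp add: s_def)
    have s: "s = (real n)\<^sup>2 * real n powr - (1 / 2)"
      using n powr_add[of "real n" 2 "- (1 / 2)"] by (simp add: s_def)
    have "(\<delta> / 2 * real n / Q)\<^sup>2 * d\<^sup>2 \<le> 2 * R + real n"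
      using f[of q l] by (simp add: d_def power2_commute)
    also have "\<dots> = 16 * Q\<^sup>2 * \<Lambda> * s + (8 * ln (1 / \<delta>) + 1) * real n"
      by (simp add: R_def algebra_simps)
    also have "\<dots> \<le> 16 * Q\<^sup>2 * \<Lambda> * s + (8 * ln (1 / \<delta>) + 1) * s"
      using n_le ln\<delta> by (intro add_left_mono mult_left_mono) auto
    also have "\<dots> = C * ((real n)\<^sup>2 * real n powr - (1 / 2))"
      by (simp add: C_def algebra_simps flip: s)
    finally have "d\<^sup>2 \<le> C * (4 * Q\<^sup>2 / \<delta>\<^sup>2) * real n powr - (1 / 2)"
      using \<delta>(1) n Q by (simp add: field_simps power2_eq_square)
    also have "\<dots> = (radius \<delta> \<zeta> CARD('q) n)\<^sup>2"
    proof -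
      have "0 \<le> C" unfolding C_def using \<Lambda> ln\<delta> by simp
      then have "0 \<le> rate_const \<delta> \<zeta> CARD('q)" by (simp add: rate_const_def C_def Q_def \<Lambda>_def)
      moreover have "(real n powr - (1 / 4))\<^sup>2 = real n powr - (1 / 2)"
        by (simp add: power2_eq_square flip: powr_add)
      ultimately show ?thesis
        by (simp add: radius_def power_mult_distrib) (simp add: rate_const_def C_def Q_def \<Lambda>_def)
    qed
    finally have "\<bar>d\<bar> \<le> \<bar>radius \<delta> \<zeta> CARD('q) n\<bar>" by (simp add: abs_le_square_iff)
    moreover have "0 \<le> radius \<delta> \<zeta> CARD('q) n"
    proof -
      have "0 \<le> rate_const \<delta> \<zeta> CARD('q)"
        using \<Lambda> ln\<delta> unfolding rate_const_def \<Lambda>_def[symmetric] by (intro mult_nonneg_nonneg add_nonneg_nonneg) auto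
      then show ?thesis by (simp add: radius_def)
    qed
    ultimately show ?thesis by (simp add: d_def)
  qed
  have "inj f"
  proof (rule injI, rule ccontr)
    fix q q' assume "f q = f q'" "q \<noteq> q'"
    then obtain l where "g \<le> \<bar>snd \<theta>' $ q $ l - snd \<theta>' $ q' $ l\<bar>" using sep(1) by (auto simp: separated_def)
    moreover have "\<bar>snd \<theta> $ f q $ f l - snd \<theta>' $ q $ l\<bar> \<le> radius \<delta> \<zeta> CARD('q) n"
      "\<bar>snd \<theta> $ f q $ f l - snd \<theta>' $ q' $ l\<bar> \<le> radius \<delta> \<zeta> CARD('q) n"
      using close[of q l] close[of q' l] \<open>f q = f q'\<close> by simp_all
    ultimately show False using sep(2) by linarith
  qed
  then have "f permutes UNIV"
    by (simp add: permutes_univ finite_UNIV_inj_surj bij_def bij_iff[symmetric])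
  then show ?thesis using close by (auto simp: label_switch_ball_def)
qed

text \<open>
  The condition that the rows of \<open>\<pi>\<close> be distinct is not closed. Near the truth it is implied by the
  separation of the rows of \<open>\<pi>'\<close>, so it can be dropped there, and the remaining conditions are closed.
\<close>

lemma compact_near_truth:
  assumes "separated g \<pi>'" "2 * \<rho> < g"
  shows "compact {\<theta> \<in> Params \<delta> \<zeta>. snd \<theta> \<in> label_switch_ball \<rho> (\<pi>' :: real ^ ('q::finite) ^ 'q)}"
proof -
  define C :: "'q param set" where "C = {\<theta>. stochastic (fst \<theta>) \<and> transpose (snd \<theta>) = snd \<theta> \<and>
      (\<forall>q l. fst \<theta> $ q $ l \<in> {\<delta>..1 - \<delta>}) \<and> (\<forall>q l. snd \<theta> $ q $ l \<in> {\<zeta>..1 - \<zeta>}) \<and>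
      snd \<theta> \<in> label_switch_ball \<rho> \<pi>'}"
  have distinct_rows: "\<exists>l. \<pi> $ q $ l \<noteq> \<pi> $ q' $ l" if ball: "\<pi> \<in> label_switch_ball \<rho> \<pi>'" and ne: "q \<noteq> q'"
    for \<pi> :: "real ^ 'q ^ 'q" and q q'
  proof -
    obtain \<sigma> where \<sigma>: "\<sigma> permutes UNIV" "\<And>q l. \<bar>\<pi> $ \<sigma> q $ \<sigma> l - \<pi>' $ q $ l\<bar> \<le> \<rho>"
      using ball by (auto simp: label_switch_ball_def)
    obtain r r' where r: "q = \<sigma> r" "q' = \<sigma> r'" "r \<noteq> r'"
      using permutes_surj[OF \<sigma>(1)] ne by (metis surjD)
    obtain l where "g \<le> \<bar>\<pi>' $ r $ l - \<pi>' $ r' $ l\<bar>"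
      using assms(1) r(3) by (auto simp: separated_def)
    then have "\<pi> $ q $ \<sigma> l \<noteq> \<pi> $ q' $ \<sigma> l"
      using \<sigma>(2)[of r l] \<sigma>(2)[of r' l] assms(2) r(1,2) by auto
    then show ?thesis by blast
  qed
  then have C_eq: "{\<theta> \<in> Params \<delta> \<zeta>. snd \<theta> \<in> label_switch_ball \<rho> \<pi>'} = C"
    unfolding C_def Params_def by (auto simp: case_prod_unfold)
  have "C = {\<theta>. \<forall>q l. 0 \<le> fst \<theta> $ q $ l} \<inter> {\<theta>. \<forall>q. (\<Sum>l\<in>UNIV. fst \<theta> $ q $ l) = 1} \<inter>
      {\<theta>. transpose (snd \<theta>) = snd \<theta>} \<inter>
      {\<theta>. \<forall>q l. \<delta> \<le> fst \<theta> $ q $ l} \<inter> {\<theta>. \<forall>q l. fst \<theta> $ q $ l \<le> 1 - \<delta>} \<inter>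
      {\<theta>. \<forall>q l. \<zeta> \<le> snd \<theta> $ q $ l} \<inter> {\<theta>. \<forall>q l. snd \<theta> $ q $ l \<le> 1 - \<zeta>} \<inter>
      (\<Union>\<sigma>\<in>{\<sigma>. \<sigma> permutes UNIV}. {\<theta>. \<forall>q l. \<bar>snd \<theta> $ \<sigma> q $ \<sigma> l - \<pi>' $ q $ l\<bar> \<le> \<rho>})"
    by (auto simp: C_def stochastic_def label_switch_ball_def)
  also have "closed \<dots>"
    unfolding transpose_def
    by (intro closed_Int closed_UN ballI finite_permutations finite_class.finite_UNIV closed_Collect_all
        closed_Collect_le closed_Collect_eq continuous_intros)
  finally have "closed C" .
  moreover have "bounded C"
  proof (rule boundedI)
    fix \<theta> assume "\<theta> \<in> C"
    then have "fst \<theta> $ q $ l \<in> {\<delta>..1 - \<delta>}" "snd \<theta> $ q $ l \<in> {\<zeta>..1 - \<zeta>}" for q l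
      by (simp_all add: C_def)
    then have entries: "\<bar>fst \<theta> $ q $ l\<bar> \<le> \<bar>\<delta>\<bar> + \<bar>1 - \<delta>\<bar>" "\<bar>snd \<theta> $ q $ l\<bar> \<le> \<bar>\<zeta>\<bar> + \<bar>1 - \<zeta>\<bar>" for q l
      by (smt (verit) atLeastAtMost_iff)+
    have norm: "norm M \<le> real CARD('q) * (real CARD('q) * b)" if "\<And>q l. \<bar>M $ q $ l\<bar> \<le> b" for M :: "real ^ 'q ^ 'q" and b
    proof -
      have "norm M \<le> (\<Sum>q\<in>UNIV. norm (M $ q))"
        unfolding norm_vec_def by (rule L2_set_le_sum) simp
      also have "\<dots> \<le> (\<Sum>q\<in>UNIV. \<Sum>l\<in>UNIV. \<bar>M $ q $ l\<bar>)"
        by (intro sum_mono norm_le_l1_cart)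
      also have "\<dots> \<le> (\<Sum>q\<in>(UNIV :: 'q set). \<Sum>l\<in>(UNIV :: 'q set). b)"
        by (intro sum_mono that)
      finally show ?thesis by simp
    qed
    have "norm \<theta> \<le> norm (fst \<theta>) + norm (snd \<theta>)" by (metis norm_Pair_le prod.collapse)
    also have "\<dots> \<le> real CARD('q) * (real CARD('q) * (\<bar>\<delta>\<bar> + \<bar>1 - \<delta>\<bar>))
        + real CARD('q) * (real CARD('q) * (\<bar>\<zeta>\<bar> + \<bar>1 - \<zeta>\<bar>))"
      by (intro add_mono norm entries)
    finally show "norm \<theta> \<le> real CARD('q) * (real CARD('q) * (\<bar>\<delta>\<bar> + \<bar>1 - \<delta>\<bar>))
        + real CARD('q) * (real CARD('q) * (\<bar>\<zeta>\<bar> + \<bar>1 - \<zeta>\<bar>))" .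
  qed
  ultimately show ?thesis unfolding C_eq by (simp add: compact_eq_bounded_closed)
qed

text \<open>
  Every parameter that does at least as well as the truth lies in a compact neighbourhood of it, so
  the continuous objective attains its maximum over all of \<^const>\<open>Params\<close>. Hence the estimator is a
  maximiser rather than arbitrary, and itself does at least as well as the truth.
\<close>

lemma estimator_close:
  fixes \<theta>' :: "('q::finite) param"
  assumes \<delta>: "0 < \<delta>" "\<delta> < 1" and \<zeta>: "0 < \<zeta>" "\<zeta> < 1 / 2"
    and n: "n \<ge> 1" and T: "T \<ge> 1" and \<theta>': "\<theta>' \<in> Params \<delta> \<zeta>"
    and X: "X \<in> adjacencies n T" and Z: "Z \<in> labellings n T"
    and bal: "balanced (\<delta> / 2 * real n) n T Z"
    and conc: "concentrated (real n powr (3 / 2)) n T (snd \<theta>') Z X"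
    and sep: "separated g (snd \<theta>')" "2 * radius \<delta> \<zeta> CARD('q) n < g"
    and chi_hat: "is_chi_hat \<delta> \<zeta> chi_hat"
    and est: "is_variational_estimator \<delta> \<zeta> chi_hat \<theta>est"
  shows "snd (\<theta>est n T X) \<in> label_switch_ball (radius \<delta> \<zeta> CARD('q) n) (snd \<theta>')"
proof -
  define J where "J \<theta> = elbo n T X (chi_hat n T X \<theta>) \<theta>" for \<theta>
  define B where "B = {\<theta> \<in> Params \<delta> \<zeta>. snd \<theta> \<in> label_switch_ball (radius \<delta> \<zeta> CARD('q) n) (snd \<theta>')}"
  have chi: "is_arg_max (\<lambda>chi. elbo n T X chi \<theta>) (\<lambda>chi. chi \<in> Vparams n T) (chi_hat n T X \<theta>)"
    if "\<theta> \<in> Params \<delta> \<zeta>" for \<theta>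
    using chi_hat n T X that by (auto simp: is_chi_hat_def)
  have close: "\<theta> \<in> B" if "\<theta> \<in> Params \<delta> \<zeta>" "J \<theta>' \<le> J \<theta>" for \<theta>
    using near_optimal_close[OF \<delta> \<zeta> n T that(1) \<theta>' X Z bal conc sep chi[OF that(1)] chi[OF \<theta>']] that
    by (simp add: B_def J_def)
  have "compact B" unfolding B_def by (rule compact_near_truth[OF sep])
  moreover have "B \<noteq> {}" using close[OF \<theta>'] by auto
  moreover have "continuous_on B J"
    unfolding J_def
    by (rule continuous_on_subset[OF continuous_on_optimal_elbo[OF \<delta>(1) \<zeta>(1) X chi]]) (auto simp: B_def)
  ultimately obtain \<theta>m where \<theta>m: "\<theta>m \<in> B" "\<And>\<theta>. \<theta> \<in> B \<Longrightarrow> J \<theta> \<le> J \<theta>m"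
    using continuous_attains_sup[of B J] by blast
  have "J \<theta> \<le> J \<theta>m" if "\<theta> \<in> Params \<delta> \<zeta>" for \<theta>
  proof (cases "J \<theta>' \<le> J \<theta>")
    case True
    then show ?thesis using close \<theta>m that by blast
  next
    case False
    then show ?thesis using \<theta>m(2)[OF close[OF \<theta>']] by simp
  qed
  then have "is_arg_max J (\<lambda>\<theta>. \<theta> \<in> Params \<delta> \<zeta>) \<theta>m"
    unfolding is_arg_max_linorder using \<theta>m(1) by (auto simp: B_def)
  then have "is_arg_max J (\<lambda>\<theta>. \<theta> \<in> Params \<delta> \<zeta>) (\<theta>est n T X)"
    using est[unfolded is_variational_estimator_def Let_def, rule_format, OF n T X]
    unfolding J_def by blast
  then have "\<theta>est n T X \<in> Params \<delta> \<zeta>" "J \<theta>' \<le> J (\<theta>est n T X)"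
    unfolding is_arg_max_linorder using \<theta>' by blast+
  then show ?thesis using close by (simp add: B_def)
qed

section \<open>Concentration of class sizes and of the graphs\<close>

text \<open>
  Hoeffding's inequality for the number of coordinates that satisfy a condition.
\<close>

lemma Pi_pmf_frequency_deviation:
  assumes A: "finite A" and I: "I \<subseteq> A" "real (card I) \<le> N" and \<epsilon>: "0 < \<epsilon>"
  shows "measure_pmf.prob (Pi_pmf A dflt p)
      {f. \<epsilon> \<le> \<bar>(\<Sum>i\<in>I. of_bool (P i (f i))) - (\<Sum>i\<in>I. measure_pmf.prob (p i) {x. P i x})\<bar>}
    \<le> 2 * exp (- 2 * \<epsilon>\<^sup>2 / N)"
proof (cases "I = {}")
  case True
  then show ?thesis using \<epsilon> by simp
next
  case False
  have fin: "finite I" using A I by (metis finite_subset)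
  then have card: "0 < real (card I)" using False by (simp add: card_gt_0_iff)
  let ?M = "measure_pmf (Pi_pmf A dflt p)"
  define X :: "'a \<Rightarrow> ('a \<Rightarrow> 'b) \<Rightarrow> real" where "X i f = of_bool (P i (f i))" for i f
  have "prob_space.indep_vars ?M (\<lambda>_. count_space UNIV) (\<lambda>x f. f x) A"
    by (rule indep_vars_Pi_pmf[OF A])
  then have "prob_space.indep_vars ?M (\<lambda>_. count_space UNIV) (\<lambda>x f. f x) I"
    by (rule prob_space.indep_vars_subset[OF measure_pmf.prob_space_axioms _ I(1)])
  then have indep: "prob_space.indep_vars ?M (\<lambda>_. borel) X I"
    unfolding X_def by (rule prob_space.indep_vars_compose2[OF measure_pmf.prob_space_axioms]) auto
  have exp: "measure_pmf.expectation (Pi_pmf A dflt p) (X i) = measure_pmf.prob (p i) {x. P i x}" if "i \<in> I" for i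
  proof -
    have "X i = indicator {f. P i (f i)}" by (auto simp: X_def fun_eq_iff)
    then have "measure_pmf.expectation (Pi_pmf A dflt p) (X i)
        = measure_pmf.prob (Pi_pmf A dflt p) ((\<lambda>f. f i) -` {x. P i x})" by (simp add: vimage_def)
    also have "\<dots> = measure_pmf.prob (map_pmf (\<lambda>f. f i) (Pi_pmf A dflt p)) {x. P i x}"
      by (simp add: measure_map_pmf)
    finally show ?thesis using A I that by (simp add: Pi_pmf_component subset_iff)
  qed
  interpret Hoeffding_ineq ?M I X "\<lambda>_. 0" "\<lambda>_. 1" "\<Sum>i\<in>I. measure_pmf.expectation (Pi_pmf A dflt p) (X i)"
    by unfold_locales (use fin indep in \<open>auto simp: X_def\<close>)
  have "measure_pmf.prob (Pi_pmf A dflt p)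
      {f. \<epsilon> \<le> \<bar>(\<Sum>i\<in>I. X i f) - (\<Sum>i\<in>I. measure_pmf.prob (p i) {x. P i x})\<bar>} \<le> 2 * exp (- 2 * \<epsilon>\<^sup>2 / real (card I))"
    using Hoeffding_ineq_abs_ge[of \<epsilon>] \<epsilon> card exp by (simp cong: sum.cong)
  also have "\<dots> \<le> 2 * exp (- 2 * \<epsilon>\<^sup>2 / N)"
    using I(2) card by (simp add: frac_le)
  finally show ?thesis by (simp add: X_def)
qed

lemma prob_Union_le_card:
  assumes "finite I" "\<And>i. i \<in> I \<Longrightarrow> measure_pmf.prob p (E i) \<le> b" "real (card I) \<le> c" "0 \<le> b"
    and "A \<subseteq> (\<Union>i\<in>I. E i)"
  shows "measure_pmf.prob p A \<le> c * b"
proof -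
  have "measure_pmf.prob p A \<le> measure_pmf.prob p (\<Union>i\<in>I. E i)"
    by (rule measure_pmf.finite_measure_mono) (use assms in auto)
  also have "\<dots> \<le> (\<Sum>i\<in>I. measure_pmf.prob p (E i))"
    by (rule measure_UNION_le) (use assms in auto)
  also have "\<dots> \<le> real (card I) * b" using assms(2) by (rule sum_bounded_above)
  also have "\<dots> \<le> c * b" using assms by (intro mult_right_mono)
  finally show ?thesis .
qed

text \<open>
  At each time a given class has expected size at least \<open>\<delta> n\<close>; a size below half of this is a
  deviation of order \<open>n\<close> of a sum of independent indicators, one per node. Union bound over times and
  classes.
\<close>

lemma prob_not_balanced_le:
  fixes \<Gamma> :: "real ^ ('q::finite) ^ 'q"
  assumes \<Gamma>: "stochastic \<Gamma>" "\<And>q l. \<delta> \<le> \<Gamma> $ q $ l" and \<delta>: "0 < \<delta>" and n: "n \<ge> 1"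
  shows "measure_pmf.prob (label_law n T \<Gamma>) {Z. \<not> balanced (\<delta> / 2 * real n) n T Z}
    \<le> (real T * real CARD('q)) * (2 * exp (- (\<delta>\<^sup>2 / 2) * real n))"
proof -
  define \<mu> where "\<mu> t q = measure_pmf.prob (markov_chain (stationary_law \<Gamma>) (\<lambda>_. transition \<Gamma>) T) {z. z t = q}" for t q
  define E where "E = (\<lambda>(t, q). {Z :: 'q labelling.
      \<delta> / 2 * real n \<le> \<bar>(\<Sum>i\<in>{1..n}. of_bool (Z i t = q)) - (\<Sum>i\<in>{1..n}. \<mu> t q)\<bar>})"
  have \<mu>: "\<delta> \<le> \<mu> t q" if "t \<in> {1..T}" for t q
    unfolding \<mu>_def
    by (rule markov_chain_marginal_ge[OF _ _ that])
       (use \<Gamma> \<delta> in \<open>auto simp: pmf_transition intro: pmf_stationary_law_ge\<close>)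
  have E: "measure_pmf.prob (label_law n T \<Gamma>) (E d) \<le> 2 * exp (- (\<delta>\<^sup>2 / 2) * real n)" for d
  proof -
    obtain t q where d: "d = (t, q)" by fastforce
    have "measure_pmf.prob (label_law n T \<Gamma>) (E (t, q)) \<le> 2 * exp (- 2 * (\<delta> / 2 * real n)\<^sup>2 / real n)"
      unfolding label_law_def E_def \<mu>_def prod.case
      by (rule Pi_pmf_frequency_deviation[where P = "\<lambda>i z. z t = q"]) (use \<delta> n in auto)
    also have "- 2 * (\<delta> / 2 * real n)\<^sup>2 / real n = - (\<delta>\<^sup>2 / 2) * real n"
      using n by (simp add: power2_eq_square field_simps)
    finally show ?thesis by (simp add: d)
  qed
  have "{Z. \<not> balanced (\<delta> / 2 * real n) n T Z} \<subseteq> (\<Union>d\<in>{1..T} \<times> UNIV. E d)"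
  proof
    fix Z :: "'q labelling" assume "Z \<in> {Z. \<not> balanced (\<delta> / 2 * real n) n T Z}"
    then obtain t q where t: "t \<in> {1..T}" and less: "real (card {i \<in> {1..n}. Z i t = q}) < \<delta> / 2 * real n"
      by (auto simp: balanced_def not_le)
    have "(\<Sum>i\<in>{1..n}. of_bool (Z i t = q)) = real (card {i \<in> {1..n}. Z i t = q})"
      by (simp add: of_bool_def sum.If_cases Int_def)
    moreover have "\<delta> * real n \<le> (\<Sum>i\<in>{1..n}. \<mu> t q)"
      using mult_left_mono[OF \<mu>[OF t, of q], of "real n"] by (simp add: mult.commute)
    ultimately have "Z \<in> E (t, q)" using less unfolding E_def by simp
    then show "Z \<in> (\<Union>d\<in>{1..T} \<times> UNIV. E d)" using t by blast
  qed
  then show ?thesis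
    by (intro prob_Union_le_card[where E = E and I = "{1..T} \<times> UNIV"] E) (auto simp: card_cartesian_product)
qed

text \<open>
  Given the labels, the noise on a rectangle is a centred sum of at most \<open>n\<^sup>2\<close> independent
  indicators, so it exceeds \<open>n\<^sup>3\<^sup>/\<^sup>2\<close> with probability at most \<open>2 e\<^sup>-\<^sup>2\<^sup>n\<close>. This beats the number \<open>4\<^sup>n\<close>
  of rectangles, which dictates the order \<open>n\<^sup>3\<^sup>/\<^sup>2\<close> of the threshold and with it the rate \<open>n\<^sup>-\<^sup>1\<^sup>/\<^sup>4\<close>.
\<close>

lemma prob_not_concentrated_le:
  fixes \<pi> :: "real ^ ('q::finite) ^ 'q"
  assumes \<pi>: "\<And>q l. \<pi> $ q $ l \<in> {0..1}" and n: "n \<ge> 1"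
  shows "measure_pmf.prob (observation_law n T \<pi> Z) {X. \<not> concentrated (real n powr (3 / 2)) n T \<pi> Z X}
    \<le> (real T * 4 ^ n) * (2 * exp (- 2 * real n))"
proof -
  define M where "M = Pi_pmf (dyads n T) False (\<lambda>(t, i, j). bernoulli_pmf (\<pi> $ Z i t $ Z j t))"
  define s where "s = real n powr (3 / 2)"
  define I where "I t A B = {t} \<times> (pairs n \<inter> A \<times> B)" for t :: nat and A B
  define E where "E = (\<lambda>(t, A, B). {e. s \<le> \<bar>(\<Sum>d\<in>I t A B. of_bool (e d))
      - (\<Sum>d\<in>I t A B. measure_pmf.prob (case d of (t, i, j) \<Rightarrow> bernoulli_pmf (\<pi> $ Z i t $ Z j t)) {b. b})\<bar>})"
  define J where "J = {1..T} \<times> Pow {1..n} \<times> Pow {1..n}"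
  have E: "measure_pmf.prob M (E x) \<le> 2 * exp (- 2 * real n)" if "x \<in> J" for x
  proof -
    obtain t A B where x: "x = (t, A, B)" by (cases x) auto
    have "card (I t A B) \<le> card ({1..n} \<times> {1..n})"
      unfolding I_def card_cartesian_product_singleton
      by (rule card_mono) (auto simp: pairs_def)
    then have card: "real (card (I t A B)) \<le> (real n)\<^sup>2"
      by (simp add: card_cartesian_product power2_eq_square flip: of_nat_mult)
    have sub: "I t A B \<subseteq> dyads n T" using that by (auto simp: I_def J_def x dyads_eq_times_pairs)
    have "0 < s" using n by (simp add: s_def)
    have "measure_pmf.prob M (E (t, A, B)) \<le> 2 * exp (- 2 * s\<^sup>2 / (real n)\<^sup>2)"
      unfolding M_def E_def prod.case
      by (rule Pi_pmf_frequency_deviation[where P = "\<lambda>_ b. b", OF finite_dyads sub card \<open>0 < s\<close>])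
    also have "s\<^sup>2 = real n * (real n)\<^sup>2"
      using n unfolding s_def power2_eq_square powr_add[symmetric] by (simp add: powr_numeral power3_eq_cube)
    also have "- 2 * (real n * (real n)\<^sup>2) / (real n)\<^sup>2 = - 2 * real n"
      using n by simp
    finally show ?thesis by (simp add: x)
  qed
  have "{e. \<not> concentrated s n T \<pi> Z (symmetrize e)} \<subseteq> (\<Union>x\<in>J. E x)"
  proof
    fix e assume "e \<in> {e. \<not> concentrated s n T \<pi> Z (symmetrize e)}"
    then obtain t A B where tAB: "t \<in> {1..T}" "A \<subseteq> {1..n}" "B \<subseteq> {1..n}"
      and less: "s < \<bar>\<Sum>(i, j)\<in>pairs n \<inter> A \<times> B. of_bool (symmetrize e t i j) - \<pi> $ Z i t $ Z j t\<bar>"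
      by (auto simp: concentrated_def not_le)
    have "(\<Sum>(i, j)\<in>pairs n \<inter> A \<times> B. of_bool (symmetrize e t i j) - \<pi> $ Z i t $ Z j t)
        = (\<Sum>(i, j)\<in>pairs n \<inter> A \<times> B. of_bool (e (t, i, j))
            - measure_pmf.prob (bernoulli_pmf (\<pi> $ Z i t $ Z j t)) {b. b})"
    proof (intro sum.cong refl, clarify)
      fix i j assume "(i, j) \<in> pairs n"
      moreover have "{b. b} = {True}" by auto
      ultimately show "of_bool (symmetrize e t i j) - \<pi> $ Z i t $ Z j t
          = of_bool (e (t, i, j)) - measure_pmf.prob (bernoulli_pmf (\<pi> $ Z i t $ Z j t)) {b. b}"
        using \<pi>[of "Z i t" "Z j t"] by (simp add: symmetrize_def pairs_def measure_pmf_single)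
    qed
    also have "\<dots> = (\<Sum>d\<in>I t A B. of_bool (e d))
      - (\<Sum>d\<in>I t A B. measure_pmf.prob (case d of (t, i, j) \<Rightarrow> bernoulli_pmf (\<pi> $ Z i t $ Z j t)) {b. b})"
      unfolding I_def sum_subtractf[symmetric] sum.cartesian_product' by (simp add: case_prod_unfold)
    finally have "e \<in> E (t, A, B)" using less by (simp add: E_def)
    then show "e \<in> (\<Union>x\<in>J. E x)" using tAB unfolding J_def by blast
  qed
  moreover have "real (card J) \<le> real T * 4 ^ n"
    by (simp add: J_def card_cartesian_product card_Pow flip: power_mult_distrib)
  moreover have "finite J" by (simp add: J_def)
  ultimately have "measure_pmf.prob M {e. \<not> concentrated s n T \<pi> Z (symmetrize e)}
      \<le> (real T * 4 ^ n) * (2 * exp (- 2 * real n))"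
    by (intro prob_Union_le_card[where E = E and I = J] E) auto
  then show ?thesis
    unfolding observation_law_def measure_map_pmf M_def s_def vimage_def by simp
qed

lemma prob_bind_Pair_le:
  assumes E: "measure_pmf.prob p {x. A x} \<le> a" and F: "\<And>x. measure_pmf.prob (k x) {y. B x y} \<le> b" and "0 \<le> b"
  shows "measure_pmf.prob (p \<bind> (\<lambda>x. map_pmf (Pair x) (k x))) {(x, y). A x \<or> B x y} \<le> a + b"
proof -
  define D where "D = p \<bind> (\<lambda>x. map_pmf (Pair x) (k x))"
  have "map_pmf fst D = p"
    by (simp add: D_def map_bind_pmf pmf.map_comp o_def bind_return_pmf')
  then have "measure_pmf.prob p {x. A x} = measure_pmf.prob D (fst -` {x. A x})"
    using measure_map_pmf[of fst D "{x. A x}"] by simp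
  also have "fst -` {x. A x} = {(x, y :: 'b). A x}" by auto
  finally have "measure_pmf.prob D {(x, y). A x} = measure_pmf.prob p {x. A x}" ..
  moreover have "emeasure (measure_pmf D) {(x, y). B x y} \<le> ennreal b"
  proof -
    have "emeasure (measure_pmf D) {(x, y). B x y} = (\<integral>\<^sup>+x. emeasure (measure_pmf (k x)) {y. B x y} \<partial>measure_pmf p)"
      unfolding D_def by (simp add: vimage_def)
    also have "\<dots> \<le> (\<integral>\<^sup>+x. ennreal b \<partial>measure_pmf p)"
      using F by (intro nn_integral_mono) (simp add: measure_pmf.emeasure_eq_measure ennreal_leI)
    finally show ?thesis by simp
  qed
  then have "measure_pmf.prob D {(x, y). B x y} \<le> b"
    using \<open>0 \<le> b\<close> by (simp add: measure_pmf.emeasure_eq_measure)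
  moreover have "measure_pmf.prob D {(x, y). A x \<or> B x y}
      \<le> measure_pmf.prob D {(x, y). A x} + measure_pmf.prob D {(x, y). B x y}"
    by (rule order_trans[OF measure_pmf.finite_measure_mono measure_Un_le]) auto
  ultimately show ?thesis using E by (simp add: D_def)
qed

lemma prob_not_regular_le:
  fixes \<theta> :: "('q::finite) param"
  assumes "0 < \<delta>" "0 < \<zeta>" "\<theta> \<in> Params \<delta> \<zeta>" "n \<ge> 1"
  shows "measure_pmf.prob (dsbm n T \<theta>) {(Z, X). \<not> balanced (\<delta> / 2 * real n) n T Z
           \<or> \<not> concentrated (real n powr (3 / 2)) n T (snd \<theta>) Z X}
    \<le> (real T * real CARD('q)) * (2 * exp (- (\<delta>\<^sup>2 / 2) * real n)) + (real T * 4 ^ n) * (2 * exp (- 2 * real n))"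
  unfolding dsbm_bind_Pair
proof (rule prob_bind_Pair_le)
  show "measure_pmf.prob (label_law n T (fst \<theta>)) {Z. \<not> balanced (\<delta> / 2 * real n) n T Z}
    \<le> (real T * real CARD('q)) * (2 * exp (- (\<delta>\<^sup>2 / 2) * real n))"
    by (rule prob_not_balanced_le[OF ParamsD(1)[OF assms(3)] ParamsD(2)[OF assms(3)] assms(1,4)])
  have "snd \<theta> $ q $ l \<in> {0..1}" for q l using ParamsD(3,4)[OF assms(3), of q l] assms(2) by auto
  then show "measure_pmf.prob (observation_law n T (snd \<theta>) Z)
      {X. \<not> concentrated (real n powr (3 / 2)) n T (snd \<theta>) Z X} \<le> (real T * 4 ^ n) * (2 * exp (- 2 * real n))" for Z
    by (rule prob_not_concentrated_le[OF _ assms(4)])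
qed simp

section \<open>Convergence rate\<close>

lemma Min_max_norm_le:
  fixes \<pi>' :: "real ^ ('q::finite) ^ 'q"
  assumes "\<pi> \<in> label_switch_ball \<rho> \<pi>'"
  shows "(MIN \<sigma>\<in>{\<sigma>. \<sigma> permutes UNIV}. max_norm (permute_labels \<sigma> \<pi> - \<pi>')) \<le> \<rho>"
proof -
  obtain \<sigma> where \<sigma>: "\<sigma> permutes UNIV" "\<And>q l. \<bar>\<pi> $ \<sigma> q $ \<sigma> l - \<pi>' $ q $ l\<bar> \<le> \<rho>"
    using assms by (auto simp: label_switch_ball_def)
  have "(MIN \<sigma>\<in>{\<sigma>. \<sigma> permutes UNIV}. max_norm (permute_labels \<sigma> \<pi> - \<pi>'))
      \<le> max_norm (permute_labels \<sigma> \<pi> - \<pi>')"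
    using \<sigma>(1) by (intro Min_le) (auto intro: finite_imageI finite_permutations)
  also have "\<dots> \<le> \<rho>"
    unfolding max_norm_def permute_labels_def using \<sigma>(2) by (intro Max.boundedI) auto
  finally show ?thesis .
qed

lemma prob_far_le:
  fixes \<theta>' :: "('q::finite) param"
  assumes \<delta>: "0 < \<delta>" "\<delta> < 1" and \<zeta>: "0 < \<zeta>" "\<zeta> < 1 / 2"
    and n: "n \<ge> 1" and T: "T \<ge> 1" and \<theta>': "\<theta>' \<in> Params \<delta> \<zeta>"
    and sep: "separated g (snd \<theta>')" "2 * radius \<delta> \<zeta> CARD('q) n < g"
    and chi_hat: "is_chi_hat \<delta> \<zeta> chi_hat"
    and est: "is_variational_estimator \<delta> \<zeta> chi_hat \<theta>est"
    and u: "radius \<delta> \<zeta> CARD('q) n \<le> u"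
  shows "measure_pmf.prob (dsbm n T \<theta>')
      {(Z, X). (MIN \<sigma>\<in>{\<sigma>. \<sigma> permutes UNIV}. max_norm (permute_labels \<sigma> (snd (\<theta>est n T X)) - snd \<theta>')) > u}
    \<le> (real T * real CARD('q)) * (2 * exp (- (\<delta>\<^sup>2 / 2) * real n)) + (real T * 4 ^ n) * (2 * exp (- 2 * real n))"
    (is "measure_pmf.prob _ ?far \<le> _")
proof -
  let ?irregular = "{(Z, X). \<not> balanced (\<delta> / 2 * real n) n T Z
      \<or> \<not> concentrated (real n powr (3 / 2)) n T (snd \<theta>') Z X}"
  have "Zx \<in> ?irregular" if Zx: "Zx \<in> set_pmf (dsbm n T \<theta>')" "Zx \<in> ?far" for Zx
  proof (rule ccontr)
    obtain Z X where Zx_eq: "Zx = (Z, X)" by fastforce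
    assume "Zx \<notin> ?irregular"
    then have reg: "balanced (\<delta> / 2 * real n) n T Z" "concentrated (real n powr (3 / 2)) n T (snd \<theta>') Z X"
      by (auto simp: Zx_eq)
    have "X \<in> adjacencies n T" "Z \<in> labellings n T" using Zx(1) set_dsbm[of n T \<theta>'] by (auto simp: Zx_eq)
    then have "snd (\<theta>est n T X) \<in> label_switch_ball (radius \<delta> \<zeta> CARD('q) n) (snd \<theta>')"
      by (rule estimator_close[OF \<delta> \<zeta> n T \<theta>' _ _ reg sep chi_hat est])
    from Min_max_norm_le[OF this] Zx(2) u show False by (auto simp: Zx_eq)
  qed
  then have "measure_pmf.prob (dsbm n T \<theta>') ?far \<le> measure_pmf.prob (dsbm n T \<theta>') ?irregular"
    by (intro measure_pmf.finite_measure_mono_AE) (auto simp: AE_measure_pmf_iff)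
  also note prob_not_regular_le[OF \<delta>(1) \<zeta>(1) \<theta>' n]
  finally show ?thesis .
qed

text \<open>
  Since \<open>ln T = o(n)\<close>, the factor \<open>T\<close> is absorbed by any exponential decay in \<open>n\<close>; the factor \<open>4\<^sup>n\<close> is
  absorbed because \<open>ln 4 < 2\<close>.
\<close>

lemma irregularity_bound_tendsto_0:
  fixes F :: "(nat \<times> nat) filter" and Q :: real
  assumes F: "F \<le> at_top \<times>\<^sub>F at_top"
    and T: "(\<lambda>(n, T). ln (real T)) \<in> o[F](\<lambda>(n, T). real n)"
    and a: "0 < a" and Q: "0 \<le> Q"
  shows "((\<lambda>(n, T). (real T * Q) * (2 * exp (- a * real n)) + (real T * 4 ^ n) * (2 * exp (- 2 * real n))) \<longlongrightarrow> 0) F"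
proof -
  \<comment> \<open>The smaller of the two exponential rates; half of it pays for \<open>T\<close>.\<close>
  define k where "k = min a (2 - ln 4)"
  have "ln (4 :: real) = 2 * ln 2" using ln_realpow[of 2 2] by simp
  then have k: "0 < k" using a ln_2_less_1 by (simp add: k_def)
  have fst: "filterlim fst at_top F"
    using filterlim_mono[OF filterlim_fst order_refl F] .
  have ev: "\<forall>\<^sub>F (n, T) in F. n \<ge> 1 \<and> T \<ge> 1"
    using F by (rule filter_leD) (auto intro!: eventually_prodI simp: case_prod_unfold eventually_ge_at_top)
  have "\<forall>\<^sub>F (n, T) in F. \<bar>ln (real T)\<bar> \<le> k / 2 * real n"
    using landau_o.smallD[OF T, of "k / 2"] k by (simp add: case_prod_unfold)
  with ev have bound: "\<forall>\<^sub>F (n, T) in F.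
      \<bar>(real T * Q) * (2 * exp (- a * real n)) + (real T * 4 ^ n) * (2 * exp (- 2 * real n))\<bar>
        \<le> (2 * Q + 2) * exp (- (k / 2) * real n)"
  proof eventually_elim
    fix x :: "nat \<times> nat"
    obtain n T where x: "x = (n, T)" by fastforce
    assume "case x of (n, T) \<Rightarrow> n \<ge> 1 \<and> T \<ge> 1" "case x of (n, T) \<Rightarrow> \<bar>ln (real T)\<bar> \<le> k / 2 * real n"
    then have "1 \<le> T" "ln (real T) \<le> k / 2 * real n" by (auto simp: x)
    then have "exp (ln (real T)) \<le> exp (k / 2 * real n)" by (simp only: exp_le_cancel_iff)
    moreover have "exp (ln (real T)) = real T" using \<open>1 \<le> T\<close> by simp
    ultimately have T: "real T \<le> exp (k / 2 * real n)" by (simp only:)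
    have absorb: "real T * exp (- b * real n) \<le> exp (- (k / 2) * real n)" if "k \<le> b" for b
    proof -
      have "real T * exp (- b * real n) \<le> exp (k / 2 * real n) * exp (- k * real n)"
        using T that by (intro mult_mono) (auto intro: mult_right_mono)
      also have "\<dots> = exp (- (k / 2) * real n)" by (simp flip: exp_add)
      finally show ?thesis .
    qed
    have "4 ^ n * exp (- 2 * real n) = exp (- (2 - ln 4) * real n)"
    proof -
      have "(4 :: real) ^ n = exp (real n * ln 4)" by (simp add: exp_of_nat_mult)
      then show ?thesis by (simp add: algebra_simps flip: exp_add)
    qed
    then have "(real T * Q) * (2 * exp (- a * real n)) + (real T * 4 ^ n) * (2 * exp (- 2 * real n))
        = 2 * Q * (real T * exp (- a * real n)) + 2 * (real T * exp (- (2 - ln 4) * real n))"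
      by (simp add: algebra_simps)
    also have "\<dots> \<le> 2 * Q * exp (- (k / 2) * real n) + 2 * exp (- (k / 2) * real n)"
      using Q by (intro add_mono mult_left_mono absorb) (auto simp: k_def)
    finally show "case x of (n, T) \<Rightarrow>
      \<bar>(real T * Q) * (2 * exp (- a * real n)) + (real T * 4 ^ n) * (2 * exp (- 2 * real n))\<bar>
        \<le> (2 * Q + 2) * exp (- (k / 2) * real n)"
      using Q by (simp add: x algebra_simps)
  qed
  have "((\<lambda>n. (2 * Q + 2) * exp (- (k / 2) * real n)) \<longlongrightarrow> 0) at_top"
    using k by real_asymp
  from filterlim_compose[OF this fst] have "((\<lambda>(n, T). (2 * Q + 2) * exp (- (k / 2) * real n)) \<longlongrightarrow> 0) F"
    by (simp add: case_prod_unfold)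
  then show ?thesis
    by (rule Lim_null_comparison[rotated]) (use bound in \<open>simp add: case_prod_unfold\<close>)
qed

theorem corollary5:
  fixes \<delta> \<zeta> \<epsilon> :: real
    and \<Gamma>' \<pi>' :: "real ^ ('q::finite) ^ 'q"
    and chi_hat :: "nat \<Rightarrow> nat \<Rightarrow> adjacency \<Rightarrow> 'q param \<Rightarrow> 'q vparam"
    and \<theta>est :: "nat \<Rightarrow> nat \<Rightarrow> adjacency \<Rightarrow> 'q param"
    and r :: "nat \<Rightarrow> nat \<Rightarrow> real"
    and F :: "(nat \<times> nat) filter"
  assumes "CARD('q) \<ge> 2"
    and "0 < \<delta>" and "\<delta> < 1 / real (CARD('q))"
    and "0 < \<zeta>" and "\<zeta> < 1 / 2"
    and "(\<Gamma>', \<pi>') \<in> Params \<delta> \<zeta>"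
    and "is_chi_hat \<delta> \<zeta> chi_hat"
    and "is_variational_estimator \<delta> \<zeta> chi_hat \<theta>est"
    and "F \<le> at_top \<times>\<^sub>F at_top"
    and "(\<lambda>(n, T). ln (real T)) \<in> o[F](\<lambda>(n, T). real n)"
    and "\<And>n T. n \<ge> 1 \<Longrightarrow> T \<ge> 1 \<Longrightarrow> 0 < r n T"
    and "filterlim (\<lambda>(n, T). r n T) at_top F"
    and "(\<lambda>(n, T). r n T) \<in> o[F](\<lambda>(n, T). real n powr (1 / 4))"
    and "0 < \<epsilon>"
  shows "((\<lambda>(n, T). 1 / 2 * measure_pmf.prob (dsbm n T (\<Gamma>', \<pi>'))
            {(Z, X). (MIN \<sigma>\<in>{\<sigma>. \<sigma> permutes UNIV}.
                 max_norm (permute_labels \<sigma> (snd (\<theta>est n T X)) - \<pi>'))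
               > \<epsilon> * r n T / real n powr (1 / 4)})
          \<longlongrightarrow> 0) F"
proof -
  define far where "far n T = {(Z :: 'q labelling, X). (MIN \<sigma>\<in>{\<sigma>. \<sigma> permutes UNIV}.
      max_norm (permute_labels \<sigma> (snd (\<theta>est n T X)) - \<pi>')) > \<epsilon> * r n T / real n powr (1 / 4)}" for n T
  define bound where "bound n T = (real T * real CARD('q)) * (2 * exp (- (\<delta>\<^sup>2 / 2) * real n))
      + (real T * 4 ^ n) * (2 * exp (- 2 * real n))" for n T :: nat
  have "\<delta> < 1"
    using assms(1,3) less_le_trans[OF assms(3), of 1] by simp
  obtain g where g: "0 < g" "separated g \<pi>'"
    using Params_separated[OF assms(6)] by auto
  have fst: "filterlim fst at_top F"
    using filterlim_mono[OF filterlim_fst order_refl assms(9)] .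
  have ev: "\<forall>\<^sub>F (n, T) in F. n \<ge> 1 \<and> T \<ge> 1"
    using assms(9) by (rule filter_leD) (auto intro!: eventually_prodI simp: case_prod_unfold eventually_ge_at_top)
  have "((\<lambda>n. 2 * radius \<delta> \<zeta> CARD('q) n) \<longlongrightarrow> 0) at_top"
    unfolding radius_def by real_asymp
  then have "\<forall>\<^sub>F n in at_top. 2 * radius \<delta> \<zeta> CARD('q) n < g"
    using g(1) by (rule order_tendstoD)
  then have ev_g: "\<forall>\<^sub>F (n, T) in F. 2 * radius \<delta> \<zeta> CARD('q) n < g"
    using fst by (auto simp: filterlim_iff case_prod_unfold)
  have ev_r: "\<forall>\<^sub>F (n, T) in F. sqrt (rate_const \<delta> \<zeta> CARD('q)) / \<epsilon> \<le> r n T"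
    using assms(12) by (auto simp: filterlim_at_top case_prod_unfold)
  \<comment> \<open>\<open>ev_g\<close> makes the matching of classes injective, \<open>ev_r\<close> puts the radius below the threshold.\<close>
  from ev ev_g ev_r have le: "\<forall>\<^sub>F (n, T) in F. \<bar>1 / 2 * measure_pmf.prob (dsbm n T (\<Gamma>', \<pi>')) (far n T)\<bar> \<le> bound n T"
  proof eventually_elim
    fix x :: "nat \<times> nat"
    obtain n T where x: "x = (n, T)" by fastforce
    assume "case x of (n, T) \<Rightarrow> n \<ge> 1 \<and> T \<ge> 1" "case x of (n, T) \<Rightarrow> 2 * radius \<delta> \<zeta> CARD('q) n < g"
      "case x of (n, T) \<Rightarrow> sqrt (rate_const \<delta> \<zeta> CARD('q)) / \<epsilon> \<le> r n T"
    then have nT: "n \<ge> 1" "T \<ge> 1" and small: "2 * radius \<delta> \<zeta> CARD('q) n < g"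
      and "sqrt (rate_const \<delta> \<zeta> CARD('q)) \<le> \<epsilon> * r n T"
      using assms(14) by (auto simp: x field_simps)
    then have u: "radius \<delta> \<zeta> CARD('q) n \<le> \<epsilon> * r n T / real n powr (1 / 4)"
      by (simp add: radius_def powr_minus_divide divide_right_mono)
    have "measure_pmf.prob (dsbm n T (\<Gamma>', \<pi>')) (far n T) \<le> bound n T"
      using prob_far_le[OF assms(2) \<open>\<delta> < 1\<close> assms(4,5) nT assms(6) _ small assms(7,8) u] g(2)
      by (simp add: far_def bound_def)
    moreover have "0 \<le> measure_pmf.prob (dsbm n T (\<Gamma>', \<pi>')) (far n T)" by simp
    ultimately show "case x of (n, T) \<Rightarrow> \<bar>1 / 2 * measure_pmf.prob (dsbm n T (\<Gamma>', \<pi>')) (far n T)\<bar> \<le> bound n T"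
      unfolding x prod.case by linarith
  qed
  have "((\<lambda>(n, T). bound n T) \<longlongrightarrow> 0) F"
    unfolding bound_def using assms(2) by (intro irregularity_bound_tendsto_0 assms(9,10)) auto
  then have "((\<lambda>(n, T). 1 / 2 * measure_pmf.prob (dsbm n T (\<Gamma>', \<pi>')) (far n T)) \<longlongrightarrow> 0) F"
    by (rule Lim_null_comparison[rotated]) (use le in \<open>simp add: case_prod_unfold\<close>)
  then show ?thesis unfolding far_def .
qed

end
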